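(* Let $(\mathcal Q,d)$ be a Hadamard space, let $\tau\in\mathcal S_0^+$, let $Y$ be a $\mathcal Q$-valued random variable concentrated on a separable set, let $m$ be a $\tau$-Fréchet mean of $Y$, and for $n\in\mathbb N$ let $m_n$ be an empirical $\tau$-Fréchet mean of $n$ independent copies $Y_1,\dots,Y_n$ of $Y$. Assume $\lim_{x\to\infty}\tau'(x)<\infty$. Assume $\tau'^{\oplus}(x)>0$ for all $x\in(0,\infty)$. Assume there exists $\xi\in(0,\infty)$ with $\mathbf E[d(Y,m)^\xi]<\infty$. Then $$\mathbf E\big[d(m,m_n)^2\big]=O\Big(\frac1n\Big)\qquad\text{as }n\to\infty.$$
   Context: A Hadamard space is a nonempty complete metric space $(\mathcal Q,d)$ such that for all $y_0,y_1\in\mathcal Q$ there is $p\in\mathcal Q$ with $\frac12 d(y_0,q)^2+\frac12 d(y_1,q)^2-\frac14 d(y_0,y_1)^2\ge d(q,p)^2$ for all $q\in\mathcal Q$; it carries its Borel $\sigma$-algebra. "Concentrated on a separable set" means $\mathbf P(Y\in\mathcal Y)=1$ for some separable $\mathcal Y\subset\mathcal Q$. $\mathcal S_0^+$ is the set of nondecreasing convex functions $\tau\colon[0,\infty)\to\mathbb R$ with $\tau(0)=0$ that are differentiable on $(0,\infty)$ with concave derivative $\tau'$ satisfying $\tau'(x)>0$ for all $x>0$. $\tau'^{\oplus}$ denotes the right derivative of $\tau'$. A $\tau$-Fréchet mean of $Y$ is any $m\in\arg\min_{q\in\mathcal Q}\mathbf E[\tau(d(Y,q))-\tau(d(Y,o))]$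 with an arbitrary reference point $o\in\mathcal Q$ (independent of $o$; well defined since $\tau'$ is bounded). $m_n\in\arg\min_{q\in\mathcal Q}\sum_{j=1}^n\tau(d(Y_j,q))$ is a measurable function of $(Y_1,\dots,Y_n)$. The $O$-statement means that there are $C<\infty$ and $n_0\in\mathbb N$ (depending on $\tau$, $\xi$ and the distribution of $Y$) such that the left side is at most $C/n$ for all $n\ge n_0$. *)

theory Defs
  imports "HOL-Probability.Probability"
begin

class hadamard_space = complete_space +
  assumes hadamard:
    "\<exists>p. \<forall>q. 1/2 * (dist y0 q)\<^sup>2 + 1/2 * (dist y1 q)\<^sup>2 - 1/4 * (dist y0 y1)\<^sup>2 \<ge> (dist q p)\<^sup>2"

text \<open>Transformations are functions on all of \<^typ>\<open>real\<close>, but only their values on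
  \<open>[0, \<infinity>)\<close> matter. In particular, at a point \<open>x > 0\<close> the derivative \<^term>\<open>deriv \<tau> x\<close> is
  determined by the values of \<open>\<tau>\<close> on \<open>(0, \<infinity>)\<close>.\<close>

definition S0_plus :: "(real \<Rightarrow> real) set" where
  "S0_plus = {\<tau>. mono_on {0..} \<tau> \<and> convex_on {0..} \<tau> \<and> \<tau> 0 = 0 \<and>
     (\<forall>x>0. \<tau> differentiable (at x)) \<and> concave_on {0<..} (deriv \<tau>) \<and> (\<forall>x>0. deriv \<tau> x > 0)}"

definition concentrated_on_separable :: "'b measure \<Rightarrow> ('b \<Rightarrow> 'a::metric_space) \<Rightarrow> bool" where
  "concentrated_on_separable M Y \<longleftrightarrow>
     (\<exists>S. separable_space (top_of_set S) \<and> \<P>(\<omega> in M. Y \<omega> \<in> S) = 1)"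

text \<open>The point \<open>r\<close> is the reference point (usually called \<open>o\<close>, which is reserved syntax here).\<close>

definition frechet_mean ::
  "(real \<Rightarrow> real) \<Rightarrow> 'b measure \<Rightarrow> ('b \<Rightarrow> 'a::metric_space) \<Rightarrow> 'a \<Rightarrow> 'a \<Rightarrow> bool" where
  "frechet_mean \<tau> M Y r m \<longleftrightarrow>
     is_arg_min (\<lambda>q. \<integral>\<omega>. \<tau> (dist (Y \<omega>) q) - \<tau> (dist (Y \<omega>) r) \<partial>M) (\<lambda>_. True) m"

definition independent_copies ::
  "'b measure \<Rightarrow> ('b \<Rightarrow> 'a::metric_space) \<Rightarrow> nat \<Rightarrow> 'c measure \<Rightarrow> (nat \<Rightarrow> 'c \<Rightarrow> 'a) \<Rightarrow> bool" where
  "independent_copies M Y n N Ys \<longleftrightarrow>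
     prob_space N \<and> prob_space.indep_vars N (\<lambda>_. borel) Ys {1..n} \<and>
     (\<forall>j\<in>{1..n}. distr N borel (Ys j) = distr M borel Y)"

text \<open>The empirical mean is \<open>F (Ys 1, \<dots>, Ys n)\<close> for a map \<open>F\<close> that is measurable with respect
  to the product of the Borel sigma-algebras. The minimization is required almost surely only:
  samples are concentrated on a separable set, and off it, in a nonseparable space, a selector of
  minimizers need not be measurable for the product sigma-algebra.\<close>

definition empirical_frechet_mean ::
  "(real \<Rightarrow> real) \<Rightarrow> nat \<Rightarrow> 'c measure \<Rightarrow> (nat \<Rightarrow> 'c \<Rightarrow> 'a::metric_space) \<Rightarrow> ('c \<Rightarrow> 'a) \<Rightarrow> bool" where
  "empirical_frechet_mean \<tau> n N Ys mn \<longleftrightarrow>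
     (\<exists>F \<in> (\<Pi>\<^sub>M j\<in>{1..n}. borel) \<rightarrow>\<^sub>M borel. \<forall>\<omega>\<in>space N. mn \<omega> = F (\<lambda>j\<in>{1..n}. Ys j \<omega>)) \<and>
     (AE \<omega> in N. is_arg_min (\<lambda>q. \<Sum>j=1..n. \<tau> (dist (Ys j \<omega>) q)) (\<lambda>_. True) (mn \<omega>))"

end

theory Submission
  imports Defs
begin

text \<open>
  Write \<open>D\<close> for the distance from \<open>m\<close> to the empirical mean and \<open>Z\<^sub>j\<close> for the distance from \<open>Y\<^sub>j\<close> to \<open>m\<close>.
  Three facts about the loss carry the proof; the locale \<open>linear_growth_loss\<close> records them in
  the form in which they are used. The loss \<open>\<tau>\<close> is Lipschitz with constant \<open>L\<close>, the limit of \<open>\<tau>'\<close>;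
  it eventually grows at least at rate \<open>L / 2\<close>; and on every bounded interval the slopes of \<open>\<tau>'\<close>
  are bounded away from 0. By the defining inequality of a Hadamard space, the last fact makes
  \<open>q \<mapsto> \<tau> (d(y, q))\<close> strongly midpoint convex as long as the distances stay bounded. Comparing a
  minimizer with the midpoint between it and another point turns this into the variance
  inequalities \<open>variance_inequality\<close> and \<open>expected_excess_ge\<close>.

  Bounded errors. Let \<open>E\<close> be the expected excess loss, relative to \<open>m\<close>, of the empirical mean on a
  fresh observation \<open>Y\<^sub>0\<close>. By the variance inequality at \<open>m\<close>, the second moment of \<open>D\<close> restricted to
  \<open>D \<le> R\<^sub>0\<close> is at most a constant times \<open>E\<close>. Exchanging \<open>Y\<^sub>0\<close> with \<open>Y\<^sub>i\<close> does not change the joint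
  law, hence \<open>E\<close> is also the expected excess at \<open>Y\<^sub>i\<close> of the mean \<open>q\<^sub>i\<close> of the sample in which \<open>Y\<^sub>0\<close>
  replaces \<open>Y\<^sub>i\<close>. Average this over \<open>i\<close>. The original mean \<open>q\<^sub>0\<close> does at least as well as \<open>m\<close> on
  the sample, so \<open>E\<close> is at most \<open>L\<close> times the average of \<open>E[d(q\<^sub>0, q\<^sub>i)]\<close>. Replacing a single
  observation changes the difference of the total losses at two points by at most \<open>2 L\<close> times
  their distance, whereas the total loss has curvature of order \<open>n\<close>, so \<open>d(q\<^sub>0, q\<^sub>i)\<close> is \<open>O(1/n)\<close>
  (\<open>replacement_stability\<close>).

  Large errors. The curvature is only available while most observations and both means are
  near \<open>m\<close>. As the loss is Lipschitz with linear growth, the mean is robust: if at most a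
  quarter of the observations is farther than \<open>t \<ge> 1\<close> from \<open>m\<close>, then \<open>D \<le> A t\<close>, where \<open>A\<close> depends
  on \<open>\<tau>\<close> only (\<open>breakdown\<close>). A large \<open>D\<close> therefore forces more than \<open>n / 4\<close> of the \<open>Z\<^sub>j\<close> to exceed
  \<open>D / (2 A)\<close>, and then the product of all \<open>1 + Z\<^sub>j\<^sup>\<xi>\<close> is at least \<open>D / (2 A)\<close> to the power
  \<open>\<xi> n / 4\<close>. That product has mean \<open>B\<^sup>n\<close>, and dividing by a large enough radius to the power
  \<open>\<xi> n / 4\<close> makes all exceptional contributions exponentially small, however small \<open>\<xi>\<close> is.

  Measurability. On a nonseparable space the distance need not be measurable for the product
  sigma-algebra. Since the observations lie almost surely in the closure of a countable set, they
  can be approximated by countable-valued maps; this gives the measurability of the distances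
  and of the event that a point minimizes the empirical loss. The latter allows the almost
  sure minimization to be moved from an arbitrary sample space to the product of the
  distribution of \<open>Y\<close>.
\<close>

section \<open>Strong midpoint convexity of the loss\<close>

text \<open>A concave function increases on an earlier interval at least as fast as on a later
  one. Applied to \<open>\<tau>'\<close>, it turns the positive right derivative at one point into a uniform
  lower bound for all slopes of \<open>\<tau>'\<close> before that point.\<close>

lemma concave_on_increment_ge:
  fixes g :: "real \<Rightarrow> real"
  assumes "concave_on I g" "s \<in> I" "t \<in> I" "u \<in> I" "v \<in> I" "s \<le> t" "t \<le> u" "u < v"
  shows "(g v - g u) / (v - u) * (t - s) \<le> g t - g s"
proof (cases "s = t")
  case False
  with assms have "s < t" by simp
  have cvx: "convex_on I (\<lambda>x. - g x)"
    using assms(1) by (simp add: concave_on_def)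
  have 1: "(- g s - (- g t)) / (s - t) \<le> (- g t - (- g v)) / (t - v)"
    using convex_on_slope_le[OF cvx, of s v t] assms \<open>s < t\<close> by simp
  have 2: "(- g t - (- g v)) / (t - v) \<le> (- g u - (- g v)) / (u - v)"
    using convex_on_slope_le(2)[OF cvx, of t v u] assms by (cases "t = u") auto
  have "(g t - g s) / (t - s) \<ge> (g v - g u) / (v - u)"
    using order_trans[OF 1 2] \<open>s < t\<close> \<open>u < v\<close> by (simp add: field_simps)
  then show ?thesis
    using \<open>s < t\<close> by (simp add: field_simps)
qed simp

text \<open>Among all triangles with given sides \<open>a\<close> and \<open>b\<close>, the degenerate one with
  \<open>d = \<bar>a - b\<bar>\<close> has the longest median, and this median is \<open>(a + b) / 2\<close>.\<close>

lemma CN_imp_le_midpoint: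
  fixes a b x d :: real
  assumes "0 \<le> a" "0 \<le> b" "\<bar>a - b\<bar> \<le> d" "x\<^sup>2 \<le> (a\<^sup>2 + b\<^sup>2) / 2 - d\<^sup>2 / 4"
  shows "x \<le> (a + b) / 2"
proof (rule power2_le_imp_le)
  have "(a - b)\<^sup>2 \<le> d\<^sup>2"
    using assms(3) by (metis abs_ge_zero power2_abs power_mono)
  then show "x\<^sup>2 \<le> ((a + b) / 2)\<^sup>2"
    using assms(4) by (simp add: power2_eq_square field_simps)
qed (use assms in simp)

text \<open>Here \<open>a\<close>, \<open>b\<close> and \<open>x\<close> stand for the distances from a point to \<open>q\<^sub>0\<close>, to \<open>q\<close> and to the midpoint
  of \<open>q\<^sub>0\<close> and \<open>q\<close>, and \<open>d\<close> for the distance from \<open>q\<^sub>0\<close> to \<open>q\<close>: the constraints are the triangle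
  inequality and the defining inequality of a Hadamard space. The property thus makes \<open>\<tau>\<close> of the
  distance strongly midpoint convex in every Hadamard space, at distances up to \<open>R\<close>.\<close>

definition strongly_midpoint_convex :: "(real \<Rightarrow> real) \<Rightarrow> real \<Rightarrow> real \<Rightarrow> bool" where
  "strongly_midpoint_convex \<tau> R \<kappa> \<longleftrightarrow> (\<forall>a b d x. 0 \<le> a \<longrightarrow> a \<le> R \<longrightarrow> 0 \<le> b \<longrightarrow> b \<le> R \<longrightarrow>
      0 \<le> x \<longrightarrow> \<bar>a - b\<bar> \<le> d \<longrightarrow> x\<^sup>2 \<le> (a\<^sup>2 + b\<^sup>2) / 2 - d\<^sup>2 / 4 \<longrightarrow>
      \<tau> x \<le> (\<tau> a + \<tau> b) / 2 - \<kappa> * d\<^sup>2)"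

text \<open>The function \<open>\<tau> x - \<kappa> / 2 * x\<^sup>2\<close> is still nondecreasing and midpoint convex, so its value
  at the median is at most the mean of its values at the two sides. For the remaining quadratic part
  the constraint on \<open>x\<close> is exactly the claim.\<close>

lemma monotone_strongly_convex_imp_strongly_midpoint_convex:
  fixes \<tau> \<tau>' :: "real \<Rightarrow> real"
  assumes cont: "continuous_on {0..} \<tau>"
    and der: "\<And>x. 0 < x \<Longrightarrow> (\<tau> has_real_derivative \<tau>' x) (at x)"
    and lower: "\<And>x. 0 < x \<Longrightarrow> x \<le> R \<Longrightarrow> \<kappa> * x \<le> \<tau>' x"
    and incr: "\<And>s t. 0 < s \<Longrightarrow> s \<le> t \<Longrightarrow> t \<le> R \<Longrightarrow> \<kappa> * (t - s) \<le> \<tau>' t - \<tau>' s"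
    and "0 \<le> \<kappa>"
  shows "strongly_midpoint_convex \<tau> R (\<kappa> / 8)"
  unfolding strongly_midpoint_convex_def
proof (intro allI impI)
  fix a b d x :: real
  assume ab: "0 \<le> a" "a \<le> R" "0 \<le> b" "b \<le> R" and "0 \<le> x"
    and d: "\<bar>a - b\<bar> \<le> d" "x\<^sup>2 \<le> (a\<^sup>2 + b\<^sup>2) / 2 - d\<^sup>2 / 4"
  have symmetric: "2 * (\<tau> ((a+b)/2) - \<kappa> / 2 * ((a+b)/2)\<^sup>2)
      \<le> (\<tau> a - \<kappa> / 2 * a\<^sup>2) + (\<tau> b - \<kappa> / 2 * b\<^sup>2)"
    if ab: "0 \<le> a" "a \<le> b" "b \<le> R" for a b
  proof -
    define c where "c = (a+b)/2"
    \<comment> \<open>Up to a constant, the sum of the values of \<open>\<tau> x - \<kappa> / 2 * x\<^sup>2\<close> at \<open>c + t\<close> and \<open>c - t\<close>.\<close>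
    define \<phi> where "\<phi> = (\<lambda>t. \<tau> (c + t) + \<tau> (c - t) - \<kappa> * t\<^sup>2)"
    have "\<phi> 0 \<le> \<phi> ((b-a)/2)"
    proof (rule DERIV_nonneg_imp_increasing_open[where f=\<phi>])
      show "0 \<le> (b-a)/2" using ab by simp
      show "continuous_on {0..(b-a)/2} \<phi>"
        unfolding \<phi>_def using ab
        by (auto intro!: continuous_intros continuous_on_compose2[OF cont] simp: c_def field_simps)
      fix t assume t: "0 < t" "t < (b-a)/2"
      have pos: "0 < c + t" "0 < c - t" "c + t \<le> R"
        using t ab by (auto simp: c_def field_simps)
      have "(\<phi> has_real_derivative \<tau>' (c + t) * 1 + \<tau>' (c - t) * (- 1) - \<kappa> * (2 * t)) (at t)"
        unfolding \<phi>_def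
        by (rule DERIV_chain2[OF der] derivative_eq_intros refl pos | simp)+
      moreover have "\<kappa> * (2 * t) \<le> \<tau>' (c + t) - \<tau>' (c - t)"
        using incr[of "c - t" "c + t"] pos t by simp
      ultimately show "\<exists>y. (\<phi> has_real_derivative y) (at t) \<and> 0 \<le> y"
        by (intro exI conjI) auto
    qed
    moreover have "c + (b-a)/2 = b" "c - (b-a)/2 = a"
      by (simp_all add: c_def field_simps)
    ultimately have "2 * \<tau> c \<le> \<tau> a + \<tau> b - \<kappa> * ((b-a)/2)\<^sup>2"
      by (simp add: \<phi>_def)
    moreover have "\<kappa> * ((b-a)/2)\<^sup>2 + \<kappa> * c\<^sup>2 = \<kappa> / 2 * a\<^sup>2 + \<kappa> / 2 * b\<^sup>2"
      by (simp add: c_def power2_eq_square field_simps)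
    ultimately show ?thesis
      by (simp add: c_def[symmetric])
  qed
  define c where "c = (a+b)/2"
  have c: "0 \<le> c" "c \<le> R" using ab by (auto simp: c_def)
  have "x \<le> c" unfolding c_def by (rule CN_imp_le_midpoint[OF ab(1) ab(3) d])
  have "\<tau> x - \<kappa> / 2 * x\<^sup>2 \<le> \<tau> c - \<kappa> / 2 * c\<^sup>2"
  proof (rule DERIV_nonneg_imp_increasing_open[where f="\<lambda>x. \<tau> x - \<kappa> / 2 * x\<^sup>2", OF \<open>x \<le> c\<close>])
    show "continuous_on {x..c} (\<lambda>x. \<tau> x - \<kappa> / 2 * x\<^sup>2)"
      using \<open>0 \<le> x\<close> by (auto intro!: continuous_intros continuous_on_subset[OF cont])
    fix t assume t: "x < t" "t < c"
    with \<open>0 \<le> x\<close> c have pos: "0 < t" "t \<le> R" by auto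
    have "((\<lambda>x. \<tau> x - \<kappa> / 2 * x\<^sup>2) has_real_derivative \<tau>' t - \<kappa> / 2 * (2 * t)) (at t)"
      by (rule der derivative_eq_intros refl pos | simp)+
    then show "\<exists>y. ((\<lambda>x. \<tau> x - \<kappa> / 2 * x\<^sup>2) has_real_derivative y) (at t) \<and> 0 \<le> y"
      using lower[OF pos] by (intro exI conjI) auto
  qed
  moreover have "2 * (\<tau> c - \<kappa> / 2 * c\<^sup>2) \<le> (\<tau> a - \<kappa> / 2 * a\<^sup>2) + (\<tau> b - \<kappa> / 2 * b\<^sup>2)"
    using symmetric[of a b] symmetric[of b a] ab unfolding c_def
    by (cases "a \<le> b") (auto simp: add.commute)
  moreover have "\<kappa> / 2 * x\<^sup>2 \<le> \<kappa> / 2 * ((a\<^sup>2 + b\<^sup>2) / 2 - d\<^sup>2 / 4)"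
    using d(2) \<open>0 \<le> \<kappa>\<close> by (intro mult_left_mono) auto
  ultimately show "\<tau> x \<le> (\<tau> a + \<tau> b) / 2 - \<kappa> / 8 * d\<^sup>2"
    by (simp add: field_simps)
qed

text \<open>Everything that the proof uses about the loss. The case \<open>\<kappa> = 0\<close> of midpoint
  convexity is available at all distances and serves for the observations far from \<open>m\<close>.\<close>

locale linear_growth_loss =
  fixes \<tau> :: "real \<Rightarrow> real" and L x\<^sub>0 :: real
  assumes L_pos: "0 < L" and x0_nonneg: "0 \<le> x\<^sub>0" and zero: "\<tau> 0 = 0"
    and lipschitz: "\<And>a b. 0 \<le> a \<Longrightarrow> 0 \<le> b \<Longrightarrow> \<bar>\<tau> a - \<tau> b\<bar> \<le> L * \<bar>a - b\<bar>"
    and growth: "\<And>x. 0 \<le> x \<Longrightarrow> L / 2 * (x - x\<^sub>0) \<le> \<tau> x"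
    and midpoint: "\<And>R. strongly_midpoint_convex \<tau> R 0"
    and strong_midpoint: "\<And>R. \<exists>\<kappa>>0. strongly_midpoint_convex \<tau> R \<kappa>"

text \<open>The derivative \<open>\<tau>'\<close> is concave with positive right derivatives, hence it increases to its
  limit \<open>L\<close>. The tangents of the convex function \<open>\<tau>\<close> therefore have slope at most \<open>L\<close>, which is the
  Lipschitz bound, and a tangent of slope at least \<open>L / 2\<close> gives the growth.\<close>

lemma S0_plus_imp_linear_growth_loss:
  assumes "\<tau> \<in> S0_plus" and lim: "(deriv \<tau> \<longlongrightarrow> L) at_top"
    and right: "\<And>x. x > 0 \<Longrightarrow> \<exists>D>0. (deriv \<tau> has_real_derivative D) (at_right x)"
  shows "\<exists>x\<^sub>0. linear_growth_loss \<tau> L x\<^sub>0"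
proof -
  define \<tau>' where "\<tau>' = deriv \<tau>"
  have mono: "mono_on {0..} \<tau>" and cvx: "convex_on {0..} \<tau>" and zero: "\<tau> 0 = 0"
    and conc: "concave_on {0<..} \<tau>'" and pos: "\<And>x. 0 < x \<Longrightarrow> 0 < \<tau>' x"
    using assms(1) by (auto simp: S0_plus_def \<tau>'_def)
  have der: "(\<tau> has_real_derivative \<tau>' x) (at x)" if "0 < x" for x
    using assms(1) that by (auto simp: S0_plus_def \<tau>'_def DERIV_deriv_iff_real_differentiable)
  have modulus: "\<exists>\<kappa>>0. (\<forall>s t. 0 < s \<longrightarrow> s \<le> t \<longrightarrow> t \<le> R \<longrightarrow> \<kappa> * (t - s) \<le> \<tau>' t - \<tau>' s)"
    if "0 < R" for R
  proof -
    obtain D where D: "0 < D" "(\<tau>' has_real_derivative D) (at_right R)"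
      using right[OF \<open>0 < R\<close>] by (auto simp: \<tau>'_def)
    then obtain e where "0 < e" "\<And>h. 0 < h \<Longrightarrow> R + h \<in> {R<..} \<Longrightarrow> h < e \<Longrightarrow> \<tau>' R < \<tau>' (R + h)"
      using has_real_derivative_pos_inc_right[of \<tau>' D R "{R<..}"] by blast
    then have "\<tau>' R < \<tau>' (R + e/2)" by simp
    then have "0 < (\<tau>' (R + e/2) - \<tau>' R) / (R + e/2 - R)"
      using \<open>0 < e\<close> by simp
    moreover have "(\<tau>' (R + e/2) - \<tau>' R) / (R + e/2 - R) * (t - s) \<le> \<tau>' t - \<tau>' s"
      if "0 < s" "s \<le> t" "t \<le> R" for s t
      using that \<open>0 < e\<close> by (intro concave_on_increment_ge[OF conc]) auto
    ultimately show ?thesis by blast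
  qed
  have incr: "\<tau>' s < \<tau>' t" if "0 < s" "s < t" for s t
  proof -
    have "0 < t" using that by simp
    from modulus[OF this] obtain \<kappa> where "\<kappa> > 0"
      and \<kappa>: "\<forall>s t'. 0 < s \<longrightarrow> s \<le> t' \<longrightarrow> t' \<le> t \<longrightarrow> \<kappa> * (t' - s) \<le> \<tau>' t' - \<tau>' s"
      by auto
    have "\<kappa> * (t - s) \<le> \<tau>' t - \<tau>' s"
      using \<kappa>[rule_format, of s t] that by simp
    moreover have "0 < \<kappa> * (t - s)" using \<open>\<kappa> > 0\<close> that by simp
    ultimately show ?thesis by linarith
  qed
  have le_L: "\<tau>' s \<le> L" if "0 < s" for s
  proof (rule tendsto_lowerbound[OF lim])
    show "\<forall>\<^sub>F x in at_top. \<tau>' s \<le> deriv \<tau> x"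
      using eventually_gt_at_top[of s] by eventually_elim (use incr that in \<open>auto simp: \<tau>'_def intro: less_imp_le\<close>)
  qed simp
  have "0 < L" using pos[of 1] le_L[of 1] by simp
  have tangent: "\<tau> c + \<tau>' c * (x - c) \<le> \<tau> x" if "0 < c" "0 \<le> x" for c x
    using convex_on_imp_above_tangent[OF cvx _ _ _ DERIV_subset[OF der[of c]], of x] that
    by auto
  have lip: "\<bar>\<tau> a - \<tau> b\<bar> \<le> L * \<bar>a - b\<bar>" if "0 \<le> a" "0 \<le> b" for a b
  proof -
    have "\<bar>\<tau> a - \<tau> b\<bar> \<le> L * \<bar>a - b\<bar>" if "0 \<le> a" "a < b" for a b
    proof -
      have "\<tau> b - \<tau> a \<le> \<tau>' b * (b - a)"
        using tangent[of b a] that by (simp add: algebra_simps)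
      also have "\<dots> \<le> L * (b - a)" using le_L[of b] that by (intro mult_right_mono) auto
      finally show ?thesis using monotone_onD[OF mono, of a b] that by simp
    qed
    from this[of a b] this[of b a] that show ?thesis
      by (cases a b rule: linorder_cases) (auto simp: abs_minus_commute)
  qed
  have cont: "continuous_on {0..} \<tau>"
  proof (rule continuous_onI)
    fix x e :: real assume "x \<in> {0..}" "0 < e"
    then show "\<exists>d>0. \<forall>x'\<in>{0..}. dist x' x < d \<longrightarrow> dist (\<tau> x') (\<tau> x) \<le> e"
      using lip[of _ x] \<open>0 < L\<close>
      by (intro exI[of _ "e / L"]) (fastforce simp: dist_real_def field_simps)
  qed
  obtain x\<^sub>0 where x0: "0 < x\<^sub>0" "L / 2 < \<tau>' x\<^sub>0"
  proof -
    have "\<forall>\<^sub>F x in at_top. L / 2 < \<tau>' x"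
      using order_tendstoD(1)[OF lim, of "L / 2"] \<open>0 < L\<close> by (simp add: \<tau>'_def)
    then have "\<forall>\<^sub>F x in at_top. L / 2 < \<tau>' x \<and> 0 < x"
      using eventually_gt_at_top[of 0] by eventually_elim auto
    then show ?thesis using that by (auto simp: eventually_at_top_linorder)
  qed
  have nonneg: "0 \<le> \<tau> x" if "0 \<le> x" for x
    using monotone_onD[OF mono, of 0 x] zero that by simp
  \<comment> \<open>Since \<open>\<tau>'\<close> is positive, its increments bound \<open>\<tau>'\<close> itself: let \<open>s\<close> tend to 0.\<close>
  have lower: "\<kappa> * x \<le> \<tau>' x" if "0 < x" "\<And>s. 0 < s \<Longrightarrow> s \<le> x \<Longrightarrow> \<kappa> * (x - s) \<le> \<tau>' x - \<tau>' s" for \<kappa> x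
  proof (rule tendsto_upperbound)
    show "((\<lambda>s. \<kappa> * (x - s)) \<longlongrightarrow> \<kappa> * x) (at_right 0)"
      by (auto intro!: tendsto_eq_intros)
    show "\<forall>\<^sub>F s in at_right 0. \<kappa> * (x - s) \<le> \<tau>' x"
      using eventually_at_right_less[of 0] eventually_at_right_real[OF \<open>0 < x\<close>]
      by eventually_elim (use that(2) pos in \<open>fastforce\<close>)
  qed simp
  show ?thesis
  proof (rule exI[of _ x\<^sub>0], rule linear_growth_loss.intro)
    show "0 < L" "0 \<le> x\<^sub>0" "\<tau> 0 = 0" using \<open>0 < L\<close> x0 zero by auto
    show "\<bar>\<tau> a - \<tau> b\<bar> \<le> L * \<bar>a - b\<bar>" if "0 \<le> a" "0 \<le> b" for a b by (fact lip[OF that])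
    show "L / 2 * (x - x\<^sub>0) \<le> \<tau> x" if "0 \<le> x" for x
    proof (cases "x \<le> x\<^sub>0")
      case True
      then have "L / 2 * (x - x\<^sub>0) \<le> 0" using \<open>0 < L\<close> by (simp add: mult_le_0_iff)
      then show ?thesis using nonneg[OF that] by simp
    next
      case False
      then have "L / 2 * (x - x\<^sub>0) \<le> \<tau>' x\<^sub>0 * (x - x\<^sub>0)"
        using x0 by (intro mult_right_mono) auto
      then show ?thesis using tangent[OF x0(1) that] nonneg[of x\<^sub>0] x0 by simp
    qed
    show "strongly_midpoint_convex \<tau> R 0" for R
    proof -
      have "\<tau>' s \<le> \<tau>' t" if "0 < s" "s \<le> t" for s t
        using incr[of s t] that by (cases "s = t") auto
      then show ?thesis
        by (intro monotone_strongly_convex_imp_strongly_midpoint_convex[OF cont der, where \<kappa>=0, simplified])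
          (use pos in \<open>auto simp: less_imp_le\<close>)
    qed
    show "\<exists>\<kappa>>0. strongly_midpoint_convex \<tau> R \<kappa>" for R
    proof -
      obtain \<kappa> where \<kappa>: "0 < \<kappa>" "\<And>s t. 0 < s \<Longrightarrow> s \<le> t \<Longrightarrow> t \<le> max R 1 \<Longrightarrow> \<kappa> * (t - s) \<le> \<tau>' t - \<tau>' s"
        using modulus[OF less_le_trans[OF zero_less_one max.cobounded2[of 1 R]]] by auto
      show ?thesis
      proof (intro exI[of _ "\<kappa> / 8"] conjI)
        show "strongly_midpoint_convex \<tau> R (\<kappa> / 8)"
          by (rule monotone_strongly_convex_imp_strongly_midpoint_convex[OF cont der])
            (use \<kappa> in \<open>auto intro!: lower\<close>)
      qed (use \<kappa> in simp)
    qed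
  qed
qed

section \<open>Robustness, variance inequality and stability of minimizers\<close>

lemma strongly_midpoint_convexD:
  assumes "strongly_midpoint_convex \<tau> R \<kappa>" "0 \<le> a" "a \<le> R" "0 \<le> b" "b \<le> R" "0 \<le> x"
    "\<bar>a - b\<bar> \<le> d" "x\<^sup>2 \<le> (a\<^sup>2 + b\<^sup>2) / 2 - d\<^sup>2 / 4"
  shows "\<tau> x \<le> (\<tau> a + \<tau> b) / 2 - \<kappa> * d\<^sup>2"
  using assms unfolding strongly_midpoint_convex_def by blast

lemma abs_dist_diff_le: "\<bar>dist z p - dist z q\<bar> \<le> dist p q" for z p q :: "'a::metric_space"
  using dist_triangle[of z p q] dist_triangle[of z q p] by (auto simp: dist_commute)

lemma hadamard_midpoint:
  fixes q0 q :: "'a::hadamard_space"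
  obtains p where "\<And>z. (dist z p)\<^sup>2 \<le> ((dist z q0)\<^sup>2 + (dist z q)\<^sup>2) / 2 - (dist q0 q)\<^sup>2 / 4"
proof -
  obtain p where p: "\<forall>z. 1/2 * (dist q0 z)\<^sup>2 + 1/2 * (dist q z)\<^sup>2 - 1/4 * (dist q0 q)\<^sup>2 \<ge> (dist z p)\<^sup>2"
    using hadamard[of q0 q] by blast
  show ?thesis
  proof (rule that)
    show "(dist z p)\<^sup>2 \<le> ((dist z q0)\<^sup>2 + (dist z q)\<^sup>2) / 2 - (dist q0 q)\<^sup>2 / 4" for z
      using p[rule_format, of z] by (simp add: dist_commute[of z] field_simps)
  qed
qed

context linear_growth_loss
begin

abbreviation total_loss :: "nat set \<Rightarrow> (nat \<Rightarrow> 'a::metric_space) \<Rightarrow> 'a \<Rightarrow> real" where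
  "total_loss I y q \<equiv> (\<Sum>j\<in>I. \<tau> (dist (y j) q))"

definition minimizes :: "nat set \<Rightarrow> (nat \<Rightarrow> 'a::metric_space) \<Rightarrow> 'a \<Rightarrow> bool" where
  "minimizes I y q \<longleftrightarrow> (\<forall>p. total_loss I y q \<le> total_loss I y p)"

definition far :: "nat set \<Rightarrow> 'a::metric_space \<Rightarrow> (nat \<Rightarrow> 'a) \<Rightarrow> real \<Rightarrow> nat set" where
  "far I m y t = {j\<in>I. t < dist (y j) m}"

lemma loss_dist_diff_le:
  fixes y p q :: "'a::metric_space"
  shows "\<bar>\<tau> (dist y p) - \<tau> (dist y q)\<bar> \<le> L * dist p q"
proof -
  have "\<bar>\<tau> (dist y p) - \<tau> (dist y q)\<bar> \<le> L * \<bar>dist y p - dist y q\<bar>"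
    by (rule lipschitz) auto
  also have "\<dots> \<le> L * dist p q"
    using L_pos abs_dist_diff_le by (intro mult_left_mono) auto
  finally show ?thesis .
qed

lemma card_far_split:
  assumes "finite I"
  shows "real (card I) = card (far I m y t) + card (I - far I m y t)"
proof -
  have "far I m y t \<subseteq> I" by (auto simp: far_def)
  then have "card I = card (far I m y t) + card (I - far I m y t)"
    using assms by (metis card_Diff_subset card_mono finite_subset le_add_diff_inverse)
  then show ?thesis by simp
qed

text \<open>Compare the total loss at a minimizer \<open>q\<close> with that at \<open>m\<close>. Each of the few far observations can
  favour \<open>q\<close> by at most \<open>L * dist q m\<close>, while each near one favours \<open>m\<close> by about half of that, up to a
  term of order \<open>t + x\<^sub>0\<close>. With three quarters of the observations near, the latter prevails
  as soon as \<open>dist q m\<close> is a large multiple of \<open>t\<close>.\<close>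

lemma breakdown:
  fixes m q :: "'a::metric_space"
  assumes I: "finite I" "I \<noteq> {}" and t: "1 \<le> t" and few: "4 * card (far I m y t) \<le> card I"
    and min: "minimizes I y q"
  shows "dist q m \<le> (9 + 3 * x\<^sub>0) * t"
proof (rule ccontr)
  assume neg: "\<not> ?thesis"
  define D where "D = dist q m"
  \<comment> \<open>A lower bound for the advantage of \<open>m\<close> at a near observation. The constants of the claim make
    it exceed \<open>L * D / 3\<close>, so that three near observations outweigh a far one.\<close>
  define v where "v = L / 2 * (D - t - x\<^sub>0) - L * t"
  define F where "F = far I m y t"
  have "F \<subseteq> I" by (auto simp: F_def far_def)
  have "0 \<le> 3 * x\<^sub>0 * (t - 1)" using x0_nonneg t by simp
  then have D: "D > 9 * t + 3 * x\<^sub>0" using neg by (simp add: D_def algebra_simps)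
  have v: "v > L * D / 3"
  proof -
    have "0 < L * (D / 6 - 3/2 * t - x\<^sub>0 / 2)" using D L_pos by simp
    then show ?thesis by (simp add: v_def algebra_simps)
  qed
  have "D \<ge> 0" by (simp add: D_def)
  have near: "v \<le> \<tau> (dist (y j) q) - \<tau> (dist (y j) m)" if "j \<in> I - F" for j
  proof -
    have "dist (y j) m \<le> t" using that by (auto simp: F_def far_def)
    then have *: "\<bar>\<tau> (dist (y j) m)\<bar> \<le> L * t"
      using lipschitz[of "dist (y j) m" 0] L_pos zero
      by (auto intro: order_trans[OF _ mult_left_mono])
    have "D - t \<le> dist (y j) q"
      using dist_triangle[of q m "y j"] \<open>dist (y j) m \<le> t\<close> by (simp add: D_def dist_commute)
    then have "L / 2 * (D - t - x\<^sub>0) \<le> L / 2 * (dist (y j) q - x\<^sub>0)"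
      using L_pos by (intro mult_left_mono) auto
    also have "\<dots> \<le> \<tau> (dist (y j) q)" by (rule growth) simp
    finally show ?thesis using * by (simp add: v_def)
  qed
  have far: "- (L * D) \<le> \<tau> (dist (y j) q) - \<tau> (dist (y j) m)" for j
    using loss_dist_diff_le[of "y j" q m] by (simp add: D_def)
  have "0 \<ge> (\<Sum>j\<in>I. \<tau> (dist (y j) q) - \<tau> (dist (y j) m))"
    using min by (simp add: minimizes_def sum_subtractf)
  also have "(\<Sum>j\<in>I. \<tau> (dist (y j) q) - \<tau> (dist (y j) m)) =
      (\<Sum>j\<in>I - F. \<tau> (dist (y j) q) - \<tau> (dist (y j) m)) + (\<Sum>j\<in>F. \<tau> (dist (y j) q) - \<tau> (dist (y j) m))"
    by (rule sum.subset_diff[OF \<open>F \<subseteq> I\<close> I(1)])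
  also have "\<dots> \<ge> (\<Sum>j\<in>I - F. v) + (\<Sum>j\<in>F. - (L * D))"
    using near far by (intro add_mono sum_mono) auto
  finally have "card (I - F) * v \<le> card F * (L * D)" by simp
  moreover have n: "real (card I) = card F + card (I - F)" "4 * real (card F) \<le> card I"
    using card_far_split[OF I(1)] few by (auto simp: F_def)
  moreover have "0 < card (I - F)"
    using n I card_gt_0_iff[of I] by linarith
  ultimately have 1: "card (I - F) * (L * D / 3) < card F * (L * D)"
    using mult_strict_left_mono[OF v, of "real (card (I - F))"] by linarith
  have "3 * card F * (L * D) \<le> card (I - F) * (L * D)"
    using n L_pos \<open>D \<ge> 0\<close> by (intro mult_right_mono) auto
  with 1 show False by simp
qed

text \<open>A minimizer is no worse than the midpoint \<open>p\<close> between it and \<open>q\<close>, and strong midpoint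
  convexity bounds the loss at \<open>p\<close>. Only the observations in \<open>J\<close> contribute curvature; for the
  others plain midpoint convexity is enough.\<close>

lemma variance_inequality:
  fixes q0 q :: "'a::hadamard_space"
  assumes I: "finite I" and min: "minimizes I y q0"
    and \<kappa>: "strongly_midpoint_convex \<tau> R \<kappa>"
    and J: "J \<subseteq> I" and near: "\<And>j. j \<in> J \<Longrightarrow> dist (y j) q0 \<le> R \<and> dist (y j) q \<le> R"
  shows "2 * \<kappa> * card J * (dist q0 q)\<^sup>2 \<le> (\<Sum>j\<in>I. \<tau> (dist (y j) q)) - (\<Sum>j\<in>I. \<tau> (dist (y j) q0))"
proof -
  obtain p where p: "\<And>z. (dist z p)\<^sup>2 \<le> ((dist z q0)\<^sup>2 + (dist z q)\<^sup>2) / 2 - (dist q0 q)\<^sup>2 / 4"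
    using hadamard_midpoint[of q0 q] by blast
  let ?s = "\<lambda>j. (\<tau> (dist (y j) q0) + \<tau> (dist (y j) q)) / 2"
  have "(\<Sum>j\<in>I. \<tau> (dist (y j) q0)) \<le> (\<Sum>j\<in>I. \<tau> (dist (y j) p))"
    using min by (simp add: minimizes_def)
  also have "\<dots> \<le> (\<Sum>j\<in>I. ?s j - (if j \<in> J then \<kappa> * (dist q0 q)\<^sup>2 else 0))"
  proof (rule sum_mono)
    fix j
    show "\<tau> (dist (y j) p) \<le> ?s j - (if j \<in> J then \<kappa> * (dist q0 q)\<^sup>2 else 0)"
      using strongly_midpoint_convexD[OF midpoint _ max.cobounded1 _ max.cobounded2 _ abs_dist_diff_le p, of "y j"]
        near[of j] strongly_midpoint_convexD[OF \<kappa> _ _ _ _ _ abs_dist_diff_le p, of "y j"]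
      by (cases "j \<in> J") auto
  qed
  also have "\<dots> = (\<Sum>j\<in>I. ?s j) - (\<Sum>j\<in>I. if j \<in> J then \<kappa> * (dist q0 q)\<^sup>2 else 0)"
    by (rule sum_subtractf)
  also have "(\<Sum>j\<in>I. if j \<in> J then \<kappa> * (dist q0 q)\<^sup>2 else 0) = card J * (\<kappa> * (dist q0 q)\<^sup>2)"
    using I J by (simp add: sum.If_cases Int_absorb1)
  also have "(\<Sum>j\<in>I. ?s j) = ((\<Sum>j\<in>I. \<tau> (dist (y j) q0)) + (\<Sum>j\<in>I. \<tau> (dist (y j) q))) / 2"
    by (simp add: sum_divide_distrib[symmetric] sum.distrib)
  finally show ?thesis by (simp add: field_simps)
qed

text \<open>The variance inequality for the sample \<open>y\<close> is quadratic in \<open>dist q q'\<close>. On the other hand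
  \<open>q'\<close> minimizes the loss of \<open>y'\<close>, which differs from that of \<open>y\<close> in one summand only, so the loss
  of \<open>y\<close> at \<open>q'\<close> exceeds that at \<open>q\<close> by at most a linear term whose constant does not grow with the sample.\<close>

lemma replacement_stability:
  fixes m q q' :: "'a::hadamard_space"
  assumes I: "finite I" "i \<in> I" and "0 < \<kappa>" and few: "4 * card (far I m y t) \<le> card I"
    and \<kappa>: "strongly_midpoint_convex \<tau> R \<kappa>"
    and R: "t + dist q m \<le> R" "t + dist q' m \<le> R"
    and min: "minimizes I y q" "minimizes I y' q'"
    and agree: "\<And>j. j \<in> I \<Longrightarrow> j \<noteq> i \<Longrightarrow> y' j = y j"
  shows "dist q q' \<le> 4 * L / (3 * \<kappa> * card I)"
proof -
  let ?S = "\<lambda>y q. \<Sum>j\<in>I. \<tau> (dist (y j) q)"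
  have "dist (y j) q \<le> R \<and> dist (y j) q' \<le> R" if "j \<in> I - far I m y t" for j
    using that R dist_triangle[of "y j" q m] dist_triangle[of "y j" q' m]
    by (auto simp: far_def dist_commute)
  then have "2 * \<kappa> * card (I - far I m y t) * (dist q q')\<^sup>2 \<le> ?S y q' - ?S y q"
    by (intro variance_inequality[OF I(1) min(1) \<kappa>]) auto
  also have "?S y q' - ?S y q =
      (?S y' q' - ?S y' q) + (\<tau> (dist (y i) q') - \<tau> (dist (y i) q)) - (\<tau> (dist (y' i) q') - \<tau> (dist (y' i) q))"
  proof -
    have "?S y' z = (?S y z - \<tau> (dist (y i) z)) + \<tau> (dist (y' i) z)" for z
      using I agree by (simp add: sum.remove[OF I] cong: sum.cong_simp)
    then show ?thesis by simp
  qed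
  also have "\<dots> \<le> 0 + L * dist q q' + L * dist q q'"
  proof -
    have "?S y' q' \<le> ?S y' q" using min(2) by (simp add: minimizes_def)
    then show ?thesis
      using loss_dist_diff_le[of "y i" q' q] loss_dist_diff_le[of "y' i" q' q]
      unfolding dist_commute[of q' q] by linarith
  qed
  finally have *: "\<kappa> * card (I - far I m y t) * (dist q q')\<^sup>2 \<le> L * dist q q'" by simp
  have "3 * real (card I) / 4 \<le> card (I - far I m y t)"
    using card_far_split[OF I(1), of m y t] few by simp
  then have "\<kappa> * (3 * real (card I) / 4) * (dist q q')\<^sup>2 \<le> \<kappa> * card (I - far I m y t) * (dist q q')\<^sup>2"
    using \<open>0 < \<kappa>\<close> by (intro mult_right_mono mult_left_mono) auto
  with * have **: "(\<kappa> * (3 * real (card I) / 4) * dist q q') * dist q q' \<le> L * dist q q'"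
    by (simp add: power2_eq_square mult.assoc)
  have "0 < card I" using I by (auto simp: card_gt_0_iff)
  show ?thesis
  proof (cases "dist q q' = 0")
    case False
    then have "\<kappa> * (3 * real (card I) / 4) * dist q q' \<le> L"
      using mult_right_le_imp_le[OF **] by simp
    then show ?thesis using \<open>0 < \<kappa>\<close> \<open>0 < card I\<close> by (simp add: field_simps)
  qed (use L_pos \<open>0 < \<kappa>\<close> in simp)
qed

end

text \<open>A substitute for counting the sets of indices with large entries: for independent entries the mean of
  the product factorizes, and by this bound it controls the probability that many entries are large.\<close>

lemma powr_le_prod_of_many_large:
  fixes z :: "nat \<Rightarrow> real"
  assumes "finite I" "1 \<le> t" "0 < \<xi>" and many: "real (card {j\<in>I. t < z j}) \<ge> k"
  shows "t powr (\<xi> * k) \<le> (\<Prod>j\<in>I. 1 + z j powr \<xi>)"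
proof -
  let ?F = "{j\<in>I. t < z j}"
  have "t powr (\<xi> * k) \<le> t powr (\<xi> * card ?F)"
    using assms by (intro powr_mono) auto
  also have "\<dots> = (\<Prod>j\<in>?F. t powr \<xi>)"
    using \<open>1 \<le> t\<close> by (simp add: powr_powr[symmetric] powr_realpow)
  also have "\<dots> \<le> (\<Prod>j\<in>?F. 1 + z j powr \<xi>)"
    using assms by (intro prod_mono) (auto intro!: add_increasing powr_mono2)
  also have "\<dots> \<le> (\<Prod>j\<in>I. 1 + z j powr \<xi>)"
    using assms(1) by (intro prod_mono2) auto
  finally show ?thesis .
qed

context linear_growth_loss
begin

text \<open>The right-hand side is the integrable random variable that dominates the indicator of
  the exceptional event that too many observations are far from \<open>m\<close>.\<close>

lemma weight_ge_one_of_many_far: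
  fixes m :: "'a::metric_space"
  assumes "finite I" "1 \<le> R\<^sub>1" "0 < (\<xi> :: real)" and many: "n < 4 * card (far I m y R\<^sub>1)"
  shows "1 \<le> R\<^sub>1 powr - (\<xi> * (n / 4)) * (\<Prod>j\<in>I. 1 + dist (y j) m powr \<xi>)"
proof -
  have "R\<^sub>1 powr (\<xi> * (n / 4)) \<le> (\<Prod>j\<in>I. 1 + dist (y j) m powr \<xi>)"
    using many by (intro powr_le_prod_of_many_large assms) (simp add: far_def)
  then show ?thesis using \<open>1 \<le> R\<^sub>1\<close> by (simp add: powr_minus field_simps)
qed

text \<open>By \<open>breakdown\<close> at the radius \<open>t = dist q m / (2 A)\<close>, more than a quarter of the
  observations is farther than \<open>t\<close> from \<open>m\<close>, so the product is at least \<open>t\<close> to the power \<open>\<xi> * card I / 4\<close>.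
  That exponent is at least 2 once the sample is large; this is how a second moment of the error is obtained from an
  arbitrarily small moment of the distance.\<close>

lemma tail_bound:
  fixes m q :: "'a::metric_space"
  assumes I: "finite I" "I \<noteq> {}" and "1 \<le> R\<^sub>1" and "0 < (\<xi> :: real)" "8 \<le> \<xi> * real (card I)"
    and min: "minimizes I y q"
    and R\<^sub>0: "R\<^sub>0 = 2 * (9 + 3 * x\<^sub>0) * R\<^sub>1" and large: "R\<^sub>0 < dist q m"
  shows "(dist q m)\<^sup>2 \<le> R\<^sub>0\<^sup>2 * (R\<^sub>1 powr - (\<xi> * (card I / 4)) * (\<Prod>j\<in>I. 1 + dist (y j) m powr \<xi>))"
proof -
  define A where "A = 9 + 3 * x\<^sub>0"
  define t where "t = dist q m / (2 * A)"
  define W where "W = (\<Prod>j\<in>I. 1 + dist (y j) m powr \<xi>)"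
  define k where "k = card I / 4"
  have A: "9 \<le> A" using x0_nonneg by (simp add: A_def)
  have Dt: "dist q m = 2 * A * t" using A by (simp add: t_def)
  have t: "R\<^sub>1 < t" using large A by (simp add: R\<^sub>0 Dt A_def[symmetric])
  have "\<not> 4 * card (far I m y t) \<le> card I"
  proof
    assume "4 * card (far I m y t) \<le> card I"
    then have "dist q m \<le> A * t"
      unfolding A_def using t \<open>1 \<le> R\<^sub>1\<close> by (intro breakdown[OF I _ _ min]) auto
    moreover have "0 < A * t" using t A \<open>1 \<le> R\<^sub>1\<close> by simp
    ultimately show False using Dt by simp
  qed
  then have W: "t powr (\<xi> * k) \<le> W"
    unfolding W_def using t \<open>1 \<le> R\<^sub>1\<close> \<open>0 < \<xi>\<close>
    by (intro powr_le_prod_of_many_large I) (auto simp: far_def k_def)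
  have "(t / R\<^sub>1)\<^sup>2 = (t / R\<^sub>1) powr 2"
    using t \<open>1 \<le> R\<^sub>1\<close> by (simp add: powr_numeral)
  also have "\<dots> \<le> (t / R\<^sub>1) powr (\<xi> * k)"
    using t \<open>1 \<le> R\<^sub>1\<close> assms(5) by (intro powr_mono) (auto simp: k_def)
  also have "\<dots> = R\<^sub>1 powr - (\<xi> * k) * t powr (\<xi> * k)"
    using t \<open>1 \<le> R\<^sub>1\<close> by (simp add: powr_divide powr_minus field_simps)
  also have "\<dots> \<le> R\<^sub>1 powr - (\<xi> * k) * W"
    using W by (intro mult_left_mono) auto
  finally have "R\<^sub>0\<^sup>2 * (t / R\<^sub>1)\<^sup>2 \<le> R\<^sub>0\<^sup>2 * (R\<^sub>1 powr - (\<xi> * k) * W)"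
    by (intro mult_left_mono) auto
  moreover have "dist q m = R\<^sub>0 * (t / R\<^sub>1)"
    using \<open>1 \<le> R\<^sub>1\<close> by (simp add: Dt R\<^sub>0 A_def)
  ultimately show ?thesis by (simp add: power_mult_distrib power_divide W_def k_def)
qed

end

section \<open>Measurability for observations with separable range\<close>

text \<open>Replacing \<open>y\<close> by \<open>c (nearest c e y)\<close> moves a point of the closure by less than \<open>e\<close> and leaves only
  countably many values.\<close>

definition nearest :: "(nat \<Rightarrow> 'a::metric_space) \<Rightarrow> real \<Rightarrow> 'a \<Rightarrow> nat" where
  "nearest c e y = (LEAST i. dist y (c i) < e)"

lemma dist_nearest_less:
  assumes "y \<in> closure (range c)" "0 < e"
  shows "dist y (c (nearest c e y)) < e"
proof -
  have "\<exists>i. dist y (c i) < e"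
    using assms by (auto simp: closure_approachable dist_commute)
  then show ?thesis unfolding nearest_def by (rule LeastI_ex)
qed

lemma measurable_nearest [measurable]: "nearest c e \<in> borel \<rightarrow>\<^sub>M count_space UNIV"
proof -
  have "Measurable.pred borel (\<lambda>y. dist y (c i) < e)" for i
    unfolding Measurable.pred_def
    by (simp add: borel_open open_Collect_less continuous_on_dist)
  then show ?thesis unfolding nearest_def by (rule measurable_Least)
qed

lemma LIMSEQ_of_dist_le:
  assumes "\<And>k. dist (u k) l \<le> K * (1 / real (Suc k))"
  shows "u \<longlonglongrightarrow> l"
proof -
  have "(\<lambda>k. K * (1 / real (Suc k))) \<longlonglongrightarrow> K * 0"
    by (intro tendsto_mult_left LIMSEQ_Suc lim_1_over_n)
  then have lim: "(\<lambda>k. K * (1 / real (Suc k))) \<longlonglongrightarrow> 0" by simp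
  have "(\<lambda>k. dist (u k) l) \<longlonglongrightarrow> 0"
    by (rule tendsto_sandwich[OF always_eventually always_eventually tendsto_const lim])
      (intro allI zero_le_dist assms)+
  then show ?thesis by (rule tendsto_dist_iff[THEN iffD2])
qed

text \<open>The distance is continuous on the product of the space with itself, but without
  separability an open set of this product need not belong to the product sigma-algebra. With \<open>X\<close> replaced by a countable-valued approximation, the distance is a
  countable case distinction between distances to fixed points.\<close>

lemma borel_measurable_dist_of_separable:
  fixes X Z :: "'b \<Rightarrow> 'a::metric_space" and c :: "nat \<Rightarrow> 'a"
  assumes [measurable]: "X \<in> M \<rightarrow>\<^sub>M borel" "Z \<in> M \<rightarrow>\<^sub>M borel"
    and X: "\<And>\<omega>. \<omega> \<in> space M \<Longrightarrow> X \<omega> \<in> closure (range c)"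
  shows "(\<lambda>\<omega>. dist (X \<omega>) (Z \<omega>)) \<in> borel_measurable M"
proof (rule borel_measurable_LIMSEQ_real)
  let ?u = "\<lambda>k \<omega>. dist (c (nearest c (1 / Suc k) (X \<omega>))) (Z \<omega>)"
  show "?u k \<in> borel_measurable M" for k
  proof (rule measurable_compose_countable[where f="\<lambda>i \<omega>. dist (c i) (Z \<omega>)"])
    show "(\<lambda>\<omega>. dist (c i) (Z \<omega>)) \<in> borel_measurable M" for i
      by (rule measurable_compose[OF assms(2)])
        (intro borel_measurable_continuous_onI continuous_intros)
  qed measurable
  fix \<omega> assume "\<omega> \<in> space M"
  have "dist (?u k \<omega>) (dist (X \<omega>) (Z \<omega>)) \<le> 1 * (1 / Suc k)" for k
    using dist_nearest_less[OF X[OF \<open>\<omega> \<in> space M\<close>], of "1 / Suc k"]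
      abs_dist_diff_le[of "Z \<omega>" "X \<omega>" "c (nearest c (1 / Suc k) (X \<omega>))"]
    by (simp add: dist_real_def dist_commute abs_minus_commute)
  then show "(\<lambda>k. ?u k \<omega>) \<longlonglongrightarrow> dist (X \<omega>) (Z \<omega>)"
    by (rule LIMSEQ_of_dist_le)
qed

text \<open>After the coordinates are replaced by countable-valued approximations, \<open>f\<close> is applied
  to a random element of a countable set, where every function is measurable; the Lipschitz
  bound lets the approximation error tend to zero.\<close>

lemma borel_measurable_Lipschitz_of_separable:
  fixes X :: "nat \<Rightarrow> 'b \<Rightarrow> 'a::metric_space" and f :: "(nat \<Rightarrow> 'a) \<Rightarrow> real"
    and c :: "nat \<Rightarrow> 'a"
  assumes I: "finite I" and X[measurable]: "\<And>j. j \<in> I \<Longrightarrow> X j \<in> M \<rightarrow>\<^sub>M borel"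
    and sep: "\<And>j \<omega>. j \<in> I \<Longrightarrow> \<omega> \<in> space M \<Longrightarrow> X j \<omega> \<in> closure (range c)"
    and lip: "\<And>y z. \<bar>f y - f z\<bar> \<le> L * (\<Sum>j\<in>I. dist (y j) (z j))" and "0 \<le> L"
  shows "(\<lambda>\<omega>. f (\<lambda>j. X j \<omega>)) \<in> borel_measurable M"
proof (rule borel_measurable_LIMSEQ_real)
  define N where "N k \<omega> = (\<lambda>j\<in>I. nearest c (1 / Suc k) (X j \<omega>))" for k \<omega>
  let ?u = "\<lambda>k \<omega>. f (\<lambda>j. c (N k \<omega> j))"
  have count: "Pi\<^sub>M I (\<lambda>_. count_space UNIV) = count_space (I \<rightarrow>\<^sub>E (UNIV :: nat set))"
    using I by (intro count_space_PiM_finite) auto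
  show "?u k \<in> borel_measurable M" for k
  proof (rule measurable_compose[where g="\<lambda>\<nu>. f (\<lambda>j. c (\<nu> j))"])
    have "N k \<in> M \<rightarrow>\<^sub>M Pi\<^sub>M I (\<lambda>_. count_space UNIV)"
      unfolding N_def by measurable
    then show "N k \<in> M \<rightarrow>\<^sub>M count_space (I \<rightarrow>\<^sub>E UNIV)"
      unfolding count .
  qed simp
  fix \<omega> assume \<omega>: "\<omega> \<in> space M"
  have "dist (?u k \<omega>) (f (\<lambda>j. X j \<omega>)) \<le> (L * card I) * (1 / Suc k)" for k
  proof -
    have "dist (?u k \<omega>) (f (\<lambda>j. X j \<omega>)) \<le> L * (\<Sum>j\<in>I. dist (c (N k \<omega> j)) (X j \<omega>))"
      unfolding dist_real_def by (rule lip)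
    also have "\<dots> \<le> L * (\<Sum>j\<in>I. 1 / Suc k)"
      using \<open>0 \<le> L\<close> dist_nearest_less[OF sep[OF _ \<omega>], of _ "1 / Suc k"]
      by (intro mult_left_mono sum_mono) (auto simp: N_def dist_commute less_imp_le)
    finally show ?thesis by simp
  qed
  then show "(\<lambda>k. ?u k \<omega>) \<longlonglongrightarrow> f (\<lambda>j. X j \<omega>)"
    by (rule LIMSEQ_of_dist_le)
qed

context linear_growth_loss
begin

lemma bdd_below_total_loss: "bdd_below (range (total_loss I y))"
proof
  fix v assume "v \<in> range (total_loss I y)"
  then obtain q where v: "v = total_loss I y q" by auto
  have "- (L / 2 * x\<^sub>0) \<le> \<tau> (dist (y j) q)" for j
  proof -
    have "- (L / 2 * x\<^sub>0) \<le> L / 2 * (dist (y j) q - x\<^sub>0)"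
      using L_pos by (simp add: algebra_simps)
    then show ?thesis using growth[of "dist (y j) q"] by simp
  qed
  then show "(\<Sum>j\<in>I. - (L / 2 * x\<^sub>0)) \<le> v" unfolding v by (intro sum_mono)
qed

text \<open>This makes the infimum over the possibly nonseparable space a measurable function of
  the sample. Thereby minimization, an uncountable intersection of events, becomes the
  measurable comparison of the loss with this infimum.\<close>

lemma minimal_loss_Lipschitz:
  fixes y z :: "nat \<Rightarrow> 'a::metric_space"
  shows "\<bar>(INF q. total_loss I y q) - (INF q. total_loss I z q)\<bar> \<le> L * (\<Sum>j\<in>I. dist (y j) (z j))"
proof -
  have *: "(INF q. total_loss I y q) \<le> (INF q. total_loss I z q) + L * (\<Sum>j\<in>I. dist (y j) (z j))"
    for y z :: "nat \<Rightarrow> 'a"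
  proof -
    have "(INF q. total_loss I y q) - L * (\<Sum>j\<in>I. dist (y j) (z j)) \<le> (INF q. total_loss I z q)"
    proof (rule cINF_greatest)
      fix q
      have "(INF q. total_loss I y q) \<le> total_loss I y q"
        by (rule cINF_lower[OF bdd_below_total_loss]) simp
      also have "\<dots> \<le> (\<Sum>j\<in>I. \<tau> (dist (z j) q) + L * dist (y j) (z j))"
      proof (rule sum_mono)
        fix j show "\<tau> (dist (y j) q) \<le> \<tau> (dist (z j) q) + L * dist (y j) (z j)"
          using loss_dist_diff_le[of q "y j" "z j"] by (simp add: dist_commute abs_le_iff)
      qed
      finally show "(INF q. total_loss I y q) - L * (\<Sum>j\<in>I. dist (y j) (z j)) \<le> total_loss I z q"
        by (simp add: sum.distrib sum_distrib_left)
    qed simp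
    then show ?thesis by simp
  qed
  from *[of y z] *[of z y] show ?thesis by (simp add: dist_commute abs_le_iff)
qed

text \<open>The values of \<open>\<tau>\<close> at negative arguments are arbitrary, so \<open>\<tau>\<close> itself may fail to be
  measurable.\<close>

lemma borel_measurable_loss:
  assumes "f \<in> borel_measurable M" "\<And>\<omega>. \<omega> \<in> space M \<Longrightarrow> 0 \<le> f \<omega>"
  shows "(\<lambda>\<omega>. \<tau> (f \<omega>)) \<in> borel_measurable M"
proof -
  have "continuous_on UNIV (\<lambda>x. \<tau> (max 0 x))"
  proof (rule continuous_onI)
    fix x e :: real assume "0 < e"
    show "\<exists>d>0. \<forall>x'\<in>UNIV. dist x' x < d \<longrightarrow> dist (\<tau> (max 0 x')) (\<tau> (max 0 x)) \<le> e"
    proof (intro exI[of _ "e / L"] conjI ballI impI)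
      fix x' assume "dist x' x < e / L"
      then have "L * \<bar>max 0 x' - max 0 x\<bar> \<le> L * (e / L)"
        using L_pos by (intro mult_left_mono) (auto simp: dist_real_def)
      then show "dist (\<tau> (max 0 x')) (\<tau> (max 0 x)) \<le> e"
        using lipschitz[of "max 0 x'" "max 0 x"] L_pos by (simp add: dist_real_def)
    qed (use \<open>0 < e\<close> L_pos in simp)
  qed
  then have "(\<lambda>\<omega>. \<tau> (max 0 (f \<omega>))) \<in> borel_measurable M"
    using borel_measurable_continuous_on assms(1) by fast
  then show ?thesis
    by (rule measurable_cong[THEN iffD1, rotated]) (use assms(2) in simp)
qed

lemma minimizes_iff_le_INF:
  "minimizes I y q \<longleftrightarrow> total_loss I y q \<le> (INF p. total_loss I y p)"
  by (subst le_cINF_iff[OF UNIV_not_empty bdd_below_total_loss]) (simp add: minimizes_def)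

lemma pred_minimizes_of_separable:
  fixes X :: "nat \<Rightarrow> 'b \<Rightarrow> 'a::metric_space" and c :: "nat \<Rightarrow> 'a"
  assumes I: "finite I" and X: "\<And>j. j \<in> I \<Longrightarrow> X j \<in> M \<rightarrow>\<^sub>M borel"
    and sep: "\<And>j \<omega>. j \<in> I \<Longrightarrow> \<omega> \<in> space M \<Longrightarrow> X j \<omega> \<in> closure (range c)"
    and Z: "Z \<in> M \<rightarrow>\<^sub>M borel"
  shows "Measurable.pred M (\<lambda>\<omega>. minimizes I (\<lambda>j. X j \<omega>) (Z \<omega>))"
proof -
  have [measurable]: "(\<lambda>\<omega>. INF p. total_loss I (\<lambda>j. X j \<omega>) p) \<in> borel_measurable M"
    by (rule borel_measurable_Lipschitz_of_separable[OF I X sep minimal_loss_Lipschitz])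
      (use L_pos in auto)
  have [measurable]: "(\<lambda>\<omega>. \<tau> (dist (X j \<omega>) (Z \<omega>))) \<in> borel_measurable M" if "j \<in> I" for j
    using that by (intro borel_measurable_loss borel_measurable_dist_of_separable[where c=c] X Z sep) auto
  show ?thesis unfolding minimizes_iff_le_INF by measurable
qed

end

section \<open>Excess loss and weights under the distribution of an observation\<close>

text \<open>\<open>P\<close> is the distribution of an observation, and \<open>range c\<close> is a countable set whose closure carries \<open>P\<close>.\<close>

locale frechet_mean_model = linear_growth_loss \<tau> L x\<^sub>0 + prob_space P
  for \<tau> :: "real \<Rightarrow> real" and L x\<^sub>0 :: real and P :: "'a::hadamard_space measure" +
  fixes m :: 'a and c :: "nat \<Rightarrow> 'a" and \<xi> :: real
  assumes sets_P [measurable_cong]: "sets P = sets borel"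
    and supported: "AE y in P. y \<in> closure (range c)"
    and optimal: "\<And>q. 0 \<le> (\<integral>y. \<tau> (dist y q) - \<tau> (dist y m) \<partial>P)"
    and \<xi>_pos: "0 < \<xi>"
    and moment: "integrable P (\<lambda>y. dist y m powr \<xi>)"
begin

sublocale Pn: product_prob_space "\<lambda>_::nat. P"
  by (intro product_prob_spaceI prob_space_axioms)

abbreviation excess :: "'a \<Rightarrow> 'a \<Rightarrow> real" where
  "excess q y \<equiv> \<tau> (dist y q) - \<tau> (dist y m)"

text \<open>By independence the mean weight of \<open>k\<close> observations is \<open>B ^ k\<close>. The radius \<open>R\<^sub>1\<close>, beyond which an observation counts as far,
  is chosen such that \<open>R\<^sub>1 powr (\<xi> / 4) = 2 * B\<close>; hence the factor \<open>\<epsilon> n\<close>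
  compensates the growth of the weight of \<open>n\<close> observations and leaves \<open>1 / 2 ^ n\<close>. The
  radius \<open>R\<^sub>0\<close> for the error is the one that goes with \<open>R\<^sub>1\<close> in \<open>tail_bound\<close>.\<close>

definition B :: real where "B = (\<integral>y. 1 + dist y m powr \<xi> \<partial>P)"

definition R\<^sub>1 :: real where "R\<^sub>1 = (2 * B) powr (4 / \<xi>)"
definition R\<^sub>0 :: real where "R\<^sub>0 = 2 * (9 + 3 * x\<^sub>0) * R\<^sub>1"

definition weight :: "nat set \<Rightarrow> (nat \<Rightarrow> 'a) \<Rightarrow> real" where
  "weight I y = (\<Prod>j\<in>I. 1 + dist (y j) m powr \<xi>)"

definition \<epsilon> :: "nat \<Rightarrow> real" where "\<epsilon> n = R\<^sub>1 powr - (\<xi> * (n / 4))"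

lemma measurable_dist_const [measurable]: "(\<lambda>y. dist y q) \<in> borel_measurable P"
  unfolding measurable_cong_sets[OF sets_P refl]
  by (intro borel_measurable_continuous_onI continuous_intros)

lemma measurable_excess [measurable]: "excess q \<in> borel_measurable P"
  by (intro borel_measurable_diff borel_measurable_loss) auto

lemma abs_excess_le: "\<bar>excess q y\<bar> \<le> L * dist q m"
  by (rule loss_dist_diff_le)

lemma integrable_excess: "integrable P (excess q)"
  by (rule integrable_const_bound[of _ "L * dist q m"]) (use abs_excess_le in auto)

lemma integrable_weight_factor: "integrable P (\<lambda>y. 1 + dist y m powr \<xi>)"
  using moment by simp

lemma B_ge_1: "1 \<le> B"
proof -
  have "(\<integral>y. 1 \<partial>P) \<le> B"
    unfolding B_def by (rule integral_mono[OF _ integrable_weight_factor]) auto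
  then show ?thesis by (simp add: prob_space)
qed

lemma R1_ge_1: "1 \<le> R\<^sub>1"
  unfolding R\<^sub>1_def using B_ge_1 \<xi>_pos by (intro ge_one_powr_ge_zero) auto

lemma R0_ge: "R\<^sub>1 \<le> R\<^sub>0" "1 \<le> R\<^sub>0" "(9 + 3 * x\<^sub>0) * R\<^sub>1 \<le> R\<^sub>0"
proof -
  have "1 * R\<^sub>1 \<le> 2 * (9 + 3 * x\<^sub>0) * R\<^sub>1"
    using R1_ge_1 x0_nonneg by (intro mult_right_mono) auto
  then show "R\<^sub>1 \<le> R\<^sub>0" by (simp add: R\<^sub>0_def)
  then show "1 \<le> R\<^sub>0" using R1_ge_1 by simp
  have "0 \<le> (9 + 3 * x\<^sub>0) * R\<^sub>1" using R1_ge_1 x0_nonneg by simp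
  then show "(9 + 3 * x\<^sub>0) * R\<^sub>1 \<le> R\<^sub>0" by (simp add: R\<^sub>0_def algebra_simps)
qed

lemma \<epsilon>_eq: "\<epsilon> n = 1 / (2 * B) ^ n"
proof -
  have "R\<^sub>1 powr - (\<xi> * (n / 4)) = (2 * B) powr (- real n)"
    using \<xi>_pos by (simp add: R\<^sub>1_def powr_powr field_simps)
  then show ?thesis
    using B_ge_1 by (simp add: \<epsilon>_def powr_minus powr_realpow field_simps)
qed

lemma \<epsilon>_pos: "0 < \<epsilon> n"
  using B_ge_1 by (simp add: \<epsilon>_eq)

lemma weight_ge_1: "1 \<le> weight I y"
  unfolding weight_def by (intro prod_ge_1) auto

lemma integrable_weight: "finite I \<Longrightarrow> integrable (Pi\<^sub>M I (\<lambda>_. P)) (weight I)"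
  unfolding weight_def by (rule Pn.product_integrable_prod[OF _ integrable_weight_factor])

lemma integral_weight: "finite I \<Longrightarrow> (\<integral>y. weight I y \<partial>Pi\<^sub>M I (\<lambda>_. P)) = B ^ card I"
  unfolding weight_def by (subst Pn.product_integral_prod[OF _ integrable_weight_factor]) (auto simp: B_def)

lemma inverse_power2_le: "1 \<le> n \<Longrightarrow> 1 / 2 ^ n \<le> 1 / real n"
  using of_nat_less_two_power[of n, where 'a=real] by (intro divide_left_mono) auto

text \<open>Markov's inequality for the moment of order \<open>\<xi>\<close>; the choice of \<open>R\<^sub>1\<close> leaves room to spare.\<close>

lemma prob_near: "1 / 2 \<le> prob {y\<in>space P. dist y m \<le> R\<^sub>1}"
proof -
  let ?F = "{y\<in>space P. R\<^sub>1 < dist y m}"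
  have F: "?F \<in> sets P" by measurable
  have "2 * B \<le> (2 * B) powr 4"
    using powr_mono[of 1 4 "2 * B"] B_ge_1 by simp
  also have "\<dots> = R\<^sub>1 powr \<xi>" using \<xi>_pos by (simp add: R\<^sub>1_def powr_powr)
  finally have R: "2 * B \<le> R\<^sub>1 powr \<xi>" .
  have "2 * B * prob ?F = (\<integral>y. 2 * B * indicator ?F y \<partial>P)"
    using F by simp
  also have "\<dots> \<le> B"
    unfolding B_def[symmetric]
  proof (subst (2) B_def, rule integral_mono[OF _ integrable_weight_factor])
    fix y assume "y \<in> space P"
    show "2 * B * indicator ?F y \<le> 1 + dist y m powr \<xi>"
    proof (cases "y \<in> ?F")
      case True
      then have "R\<^sub>1 powr \<xi> \<le> dist y m powr \<xi>"
        using R1_ge_1 \<xi>_pos by (intro powr_mono2) auto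
      with True R show ?thesis by simp
    qed simp
  qed (use F in \<open>auto intro!: integrable_mult_right integrable_real_indicator simp: emeasure_eq_measure\<close>)
  finally have "prob ?F \<le> 1 / 2" using B_ge_1 by simp
  moreover have "{y\<in>space P. dist y m \<le> R\<^sub>1} = space P - ?F" by auto
  ultimately show ?thesis using prob_compl[OF F] by simp
qed

text \<open>The variance inequality for \<open>P\<close> in place of a sample: compare \<open>m\<close> with the midpoint \<open>p\<close>
  between \<open>m\<close> and \<open>q\<close>. Curvature comes from the observations within \<open>R\<^sub>1\<close> of \<open>m\<close>, which have
  probability at least one half.\<close>

lemma expected_excess_ge:
  assumes \<kappa>: "strongly_midpoint_convex \<tau> (R\<^sub>1 + R\<^sub>0) \<kappa>" "0 < \<kappa>" and q: "dist q m \<le> R\<^sub>0"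
  shows "\<kappa> * (dist q m)\<^sup>2 \<le> (\<integral>y. excess q y \<partial>P)"
proof -
  obtain p where p: "\<And>z. (dist z p)\<^sup>2 \<le> ((dist z m)\<^sup>2 + (dist z q)\<^sup>2) / 2 - (dist m q)\<^sup>2 / 4"
    using hadamard_midpoint[of m q] by blast
  let ?N = "{y\<in>space P. dist y m \<le> R\<^sub>1}"
  define \<delta> where "\<delta> = \<kappa> * (dist m q)\<^sup>2"
  have N: "?N \<in> sets P" by measurable
  have int: "integrable P (\<lambda>y. excess q y / 2)" "integrable P (\<lambda>y. \<delta> * indicator ?N y)"
    using N integrable_excess[of q]
    by (auto intro!: integrable_mult_right integrable_real_indicator simp: emeasure_eq_measure)
  have "0 \<le> (\<integral>y. excess p y \<partial>P)" by (rule optimal)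
  also have "\<dots> \<le> (\<integral>y. excess q y / 2 - \<delta> * indicator ?N y \<partial>P)"
  proof (rule integral_mono)
    fix y assume y: "y \<in> space P"
    show "excess p y \<le> excess q y / 2 - \<delta> * indicator ?N y"
    proof (cases "y \<in> ?N")
      case True
      then have "dist y m \<le> R\<^sub>1 + R\<^sub>0" "dist y q \<le> R\<^sub>1 + R\<^sub>0"
        using q R0_ge dist_triangle[of y q m] by (auto simp: dist_commute)
      then show ?thesis
        using strongly_midpoint_convexD[OF \<kappa>(1) _ _ _ _ _ abs_dist_diff_le p, of y] True
        by (simp add: \<delta>_def field_simps)
    next
      case False
      then show ?thesis
        using strongly_midpoint_convexD[OF midpoint _ max.cobounded1 _ max.cobounded2 _ abs_dist_diff_le p, of y] y
        by (simp add: field_simps)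
    qed
  qed (rule integrable_excess Bochner_Integration.integrable_diff[OF int])+
  also have "\<dots> = (\<integral>y. excess q y \<partial>P) / 2 - \<delta> * prob ?N"
    using Bochner_Integration.integral_diff[OF int] N by simp
  finally have "2 * (\<delta> * prob ?N) \<le> (\<integral>y. excess q y \<partial>P)" by simp
  moreover have "\<delta> * (1 / 2) \<le> \<delta> * prob ?N"
    using prob_near \<kappa>(2) by (intro mult_left_mono) (auto simp: \<delta>_def)
  ultimately show ?thesis by (simp add: \<delta>_def dist_commute)
qed

end

section \<open>Replacing one observation by a spare one\<close>

lemma prod_subsample_le:
  fixes h :: "'i \<Rightarrow> real"
  assumes "inj_on g I" "g ` I \<subseteq> K" "finite K" "\<And>k. k \<in> K \<Longrightarrow> 1 \<le> h k"
  shows "(\<Prod>j\<in>I. h (g j)) \<le> (\<Prod>k\<in>K. h k)"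
proof -
  have "(\<Prod>j\<in>I. h (g j)) = (\<Prod>k\<in>g ` I. h k)"
    using prod.reindex[OF assms(1), of h] by simp
  also have "\<dots> \<le> (\<Prod>k\<in>K. h k)"
    using assms order_trans[OF zero_le_one] by (intro prod_mono2) auto
  finally show ?thesis .
qed

text \<open>The sample has a spare observation with index \<open>0\<close>. In \<open>resample n i y\<close> it takes the place of
  observation \<open>i\<close>; for \<open>i = 0\<close> nothing is replaced and the original sample is returned.\<close>

definition replace_index :: "nat \<Rightarrow> nat \<Rightarrow> nat" where
  "replace_index i j = (if j = i then 0 else j)"

definition resample :: "nat \<Rightarrow> nat \<Rightarrow> (nat \<Rightarrow> 'a) \<Rightarrow> nat \<Rightarrow> 'a" where
  "resample n i y = (\<lambda>j\<in>{1..n}. y (replace_index i j))"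

lemma inj_on_replace_index: "inj_on (replace_index i) {1..n}"
  by (auto simp: inj_on_def replace_index_def split: if_splits)

lemma replace_index_subset: "replace_index i ` {1..n} \<subseteq> {0..n}"
  by (auto simp: replace_index_def)

context frechet_mean_model
begin

abbreviation Sample :: "nat set \<Rightarrow> (nat \<Rightarrow> 'a) measure" where
  "Sample I \<equiv> Pi\<^sub>M I (\<lambda>_. P)"

lemma distr_resample:
  "distr (Sample {0..n}) (Sample {1..n}) (resample n i) = Sample {1..n}"
  unfolding resample_def
  using distr_PiM_reindex[of "{0..n}" "\<lambda>_. P" "replace_index i" "{1..n}"]
    inj_on_replace_index[of i n] replace_index_subset[of i n]
  by (auto simp: prob_space_axioms)

lemma measurable_resample [measurable]: "resample n i \<in> Sample {0..n} \<rightarrow>\<^sub>M Sample {1..n}"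
  unfolding resample_def
  by (rule measurable_restrict) (auto simp: replace_index_def intro!: measurable_component_singleton)

lemma AE_resample: "AE y in Sample {1..n}. Q y \<Longrightarrow> AE y in Sample {0..n}. Q (resample n i y)"
  by (rule AE_distrD[OF measurable_resample, unfolded distr_resample])

lemma weight_resample_le: "weight {1..n} (resample n i y) \<le> weight {0..n} y"
  unfolding weight_def resample_def
  using prod_subsample_le[OF inj_on_replace_index replace_index_subset, of n "\<lambda>k. 1 + dist (y k) m powr \<xi>" i]
  by simp

lemma card_far_resample_le:
  "card (far {1..n} m (resample n i y) t) \<le> card (far {0..n} m y t)"
proof (rule card_inj_on_le)
  show "inj_on (replace_index i) (far {1..n} m (resample n i y) t)"
    by (rule inj_on_subset[OF inj_on_replace_index[of i n]]) (auto simp: far_def)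
  show "replace_index i ` far {1..n} m (resample n i y) t \<subseteq> far {0..n} m y t"
    by (auto simp: far_def resample_def replace_index_def)
  show "finite (far {0..n} m y t)" by (simp add: far_def)
qed

lemma squared_error_le_weight:
  assumes "1 \<le> n" "8 \<le> \<xi> * n" "minimizes {1..n} y q" "R\<^sub>0 < dist q m"
  shows "(dist q m)\<^sup>2 \<le> R\<^sub>0\<^sup>2 * (\<epsilon> n * weight {1..n} y)"
  using tail_bound[of "{1..n}" R\<^sub>1 \<xi> y q R\<^sub>0 m] assms R1_ge_1 \<xi>_pos
  by (simp add: R\<^sub>0_def \<epsilon>_def weight_def)

lemma error_le_weight:
  assumes "1 \<le> n" "8 \<le> \<xi> * n" "minimizes {1..n} y q"
  shows "dist q m \<le> R\<^sub>0 + R\<^sub>0\<^sup>2 * (\<epsilon> n * weight {1..n} y)"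
proof (cases "dist q m \<le> R\<^sub>0")
  case True
  have "0 \<le> R\<^sub>0\<^sup>2 * (\<epsilon> n * weight {1..n} y)"
    using \<epsilon>_pos[of n] weight_ge_1[of "{1..n}" y] by simp
  then show ?thesis using True by linarith
next
  case False
  then have "1 * dist q m \<le> (dist q m)\<^sup>2"
    unfolding power2_eq_square using R0_ge by (intro mult_right_mono) auto
  then show ?thesis
    using squared_error_le_weight[OF assms] False R0_ge by linarith
qed

text \<open>On the exceptional event the whole error, not only its part beyond \<open>R\<^sub>0\<close>, is dominated
  by the weight: there the weight times \<open>\<epsilon> n\<close> is at least 1. The weight of all \<open>n + 1\<close>
  observations is used, because it does not depend on which of them is left out.\<close>

lemma error_le_weight_of_many_far:
  assumes "1 \<le> n" "8 \<le> \<xi> * n" "minimizes {1..n} (resample n i y) q"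
    and many: "n < 4 * card (far {0..n} m y R\<^sub>1)"
  shows "dist q m \<le> R\<^sub>0\<^sup>2 * (\<epsilon> n * weight {0..n} y)"
proof (cases "dist q m \<le> R\<^sub>0")
  case True
  have "1 \<le> \<epsilon> n * weight {0..n} y"
    using weight_ge_one_of_many_far[OF _ R1_ge_1 \<xi>_pos many] by (simp add: \<epsilon>_def weight_def)
  moreover have "R\<^sub>0 \<le> R\<^sub>0\<^sup>2" using R0_ge by (simp add: power2_eq_square)
  ultimately have "R\<^sub>0 * 1 \<le> R\<^sub>0\<^sup>2 * (\<epsilon> n * weight {0..n} y)"
    using R0_ge by (intro mult_mono) auto
  then show ?thesis using True by simp
next
  case False
  then have "1 * dist q m \<le> (dist q m)\<^sup>2"
    unfolding power2_eq_square using R0_ge by (intro mult_right_mono) auto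
  also have "\<dots> \<le> R\<^sub>0\<^sup>2 * (\<epsilon> n * weight {1..n} (resample n i y))"
    using squared_error_le_weight[OF assms(1-3)] False by simp
  also have "\<dots> \<le> R\<^sub>0\<^sup>2 * (\<epsilon> n * weight {0..n} y)"
    using weight_resample_le \<epsilon>_pos[of n] by (intro mult_left_mono) auto
  finally show ?thesis by simp
qed

text \<open>If few of all \<open>n + 1\<close> observations are far, then few are far in both samples, and
  \<open>breakdown\<close> keeps both means within \<open>R\<^sub>0\<close> of \<open>m\<close>, as \<open>replacement_stability\<close> requires. Otherwise the distance
  of each mean from \<open>m\<close> is at most half of the second term.\<close>

lemma resample_stability:
  assumes n: "1 \<le> n" "8 \<le> \<xi> * n" and i: "i \<in> {1..n}"
    and \<kappa>: "strongly_midpoint_convex \<tau> (R\<^sub>1 + R\<^sub>0) \<kappa>" "0 < \<kappa>"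
    and min: "minimizes {1..n} (resample n 0 y) q" "minimizes {1..n} (resample n i y) q'"
  shows "dist q q' \<le> 4 * L / (3 * \<kappa> * n) + 2 * R\<^sub>0\<^sup>2 * (\<epsilon> n * weight {0..n} y)" (is "_ \<le> ?A + ?W")
proof (cases "4 * card (far {0..n} m y R\<^sub>1) \<le> n")
  case True
  have few: "4 * card (far {1..n} m (resample n i y) R\<^sub>1) \<le> card {1..n}" for i
    using True card_far_resample_le[of n i y R\<^sub>1] by simp
  have "dist q m \<le> R\<^sub>0" "dist q' m \<le> R\<^sub>0"
    using breakdown[OF _ _ R1_ge_1 few min(1)] breakdown[OF _ _ R1_ge_1 few min(2)] n R0_ge by auto
  then have "dist q q' \<le> 4 * L / (3 * \<kappa> * card {1..n})"
    by (intro replacement_stability[OF _ i \<kappa>(2) few \<kappa>(1) _ _ min])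
      (auto simp: resample_def replace_index_def)
  then have "dist q q' \<le> ?A" by simp
  moreover have "0 \<le> ?W"
    using \<epsilon>_pos[of n] weight_ge_1[of "{0..n}" y] by simp
  ultimately show ?thesis by linarith
next
  case False
  then have "dist q m \<le> R\<^sub>0\<^sup>2 * (\<epsilon> n * weight {0..n} y)" "dist q' m \<le> R\<^sub>0\<^sup>2 * (\<epsilon> n * weight {0..n} y)"
    using error_le_weight_of_many_far[OF n min(1)] error_le_weight_of_many_far[OF n min(2)] by auto
  moreover have "0 \<le> 4 * L / (3 * \<kappa> * n)" using L_pos \<kappa> by simp
  ultimately show ?thesis using dist_triangle2[of q q' m] by linarith
qed

text \<open>A version of the observation that lies in the closure of \<open>range c\<close> everywhere and not
  only almost surely.\<close>

definition to_support :: "'a \<Rightarrow> 'a" where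
  "to_support y = (if y \<in> closure (range c) then y else c 0)"

lemma measurable_to_support [measurable]: "to_support \<in> P \<rightarrow>\<^sub>M borel"
proof -
  have "{y \<in> space P. y \<in> closure (range c)} = closure (range c)"
    using sets_eq_imp_space_eq[OF sets_P] by auto
  then have "Measurable.pred P (\<lambda>y. y \<in> closure (range c))"
    unfolding pred_def by (simp add: sets_P)
  moreover have "(\<lambda>y. y) \<in> P \<rightarrow>\<^sub>M borel"
    unfolding measurable_cong_sets[OF sets_P refl] by simp
  ultimately show ?thesis unfolding to_support_def by measurable
qed

lemma to_support_in: "to_support y \<in> closure (range c)"
  using closure_subset[of "range c"] by (auto simp: to_support_def)

lemma AE_to_support: "AE y in P. to_support y = y"
  using supported by eventually_elim (simp add: to_support_def)

lemma integral_excess_to_support: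
  "(\<integral>z. excess q (to_support z) \<partial>P) = (\<integral>z. excess q z \<partial>P)"
proof (rule integral_cong_AE)
  show "(\<lambda>z. excess q (to_support z)) \<in> borel_measurable P"
    by (rule measurable_compose[OF measurable_to_support])
      (rule measurable_excess[unfolded measurable_cong_sets[OF sets_P refl]])
  show "AE z in P. excess q (to_support z) = excess q z"
    using AE_to_support by eventually_elim simp
qed measurable

lemma AE_sample_to_support: "finite I \<Longrightarrow> AE y in Sample I. \<forall>j\<in>I. to_support (y j) = y j"
  by (subst AE_finite_all) (auto intro!: AE_PiM_component prob_space_axioms AE_to_support)

text \<open>Exchangeability: transposing the coordinates \<open>0\<close> and \<open>i\<close> preserves the product measure
  and exchanges the roles of the spare observation and of observation \<open>i\<close>. For the spare observation,
  which is independent of the original sample, Fubini's theorem gives the expected excess.\<close>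

lemma integral_resample_excess:
  fixes n :: nat and F :: "(nat \<Rightarrow> 'a) \<Rightarrow> 'a"
  assumes n: "1 \<le> n" "8 \<le> \<xi> * n" and F[measurable]: "F \<in> Sample {1..n} \<rightarrow>\<^sub>M borel"
    and min: "AE y in Sample {1..n}. minimizes {1..n} y (F y)" and i: "i \<in> {0..n}"
  defines "H \<equiv> \<lambda>i y. excess (F (resample n i y)) (to_support (y i))"
  shows "integrable (Sample {0..n}) (H i)"
    and "(\<integral>y. H i y \<partial>Sample {0..n}) = (\<integral>x. \<integral>z. excess (F x) z \<partial>P \<partial>Sample {1..n})"
proof -
  interpret S: prob_space "Sample {0..n}" by (rule prob_space_PiM) (rule prob_space_axioms)
  have [measurable]: "(\<lambda>y. to_support (y i)) \<in> Sample {0..n} \<rightarrow>\<^sub>M borel" if "i \<in> {0..n}" for i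
    using that by (intro measurable_compose[OF measurable_component_singleton]) auto
  have meas: "H i \<in> borel_measurable (Sample {0..n})" if "i \<in> {0..n}" for i
    unfolding H_def using that
    by (intro borel_measurable_diff borel_measurable_loss borel_measurable_dist_of_separable[where c=c])
      (auto intro!: to_support_in)
  have int: "integrable (Sample {0..n}) (H i)" if i: "i \<in> {0..n}" for i
  proof (rule Bochner_Integration.integrable_bound)
    show "integrable (Sample {0..n}) (\<lambda>y. L * (R\<^sub>0 + R\<^sub>0\<^sup>2 * (\<epsilon> n * weight {0..n} y)))"
      by (intro integrable_mult_right Bochner_Integration.integrable_add integrable_weight S.integrable_const) auto
    show "AE y in Sample {0..n}. norm (H i y) \<le> norm (L * (R\<^sub>0 + R\<^sub>0\<^sup>2 * (\<epsilon> n * weight {0..n} y)))"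
      using AE_resample[OF min, of i]
    proof eventually_elim
      fix y assume "minimizes {1..n} (resample n i y) (F (resample n i y))"
      then have "dist (F (resample n i y)) m \<le> R\<^sub>0 + R\<^sub>0\<^sup>2 * (\<epsilon> n * weight {1..n} (resample n i y))"
        by (rule error_le_weight[OF n])
      also have "\<dots> \<le> R\<^sub>0 + R\<^sub>0\<^sup>2 * (\<epsilon> n * weight {0..n} y)"
        using weight_resample_le \<epsilon>_pos[of n] by (intro add_left_mono mult_left_mono) auto
      finally have "L * dist (F (resample n i y)) m \<le> L * (R\<^sub>0 + R\<^sub>0\<^sup>2 * (\<epsilon> n * weight {0..n} y))"
        using L_pos by (intro mult_left_mono) auto
      then show "norm (H i y) \<le> norm (L * (R\<^sub>0 + R\<^sub>0\<^sup>2 * (\<epsilon> n * weight {0..n} y)))"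
        using abs_excess_le[of "to_support (y i)" "F (resample n i y)"] unfolding H_def real_norm_def
        by linarith
    qed
  qed (rule meas[OF i])
  show "integrable (Sample {0..n}) (H i)" by (rule int[OF i])
  define T where "T y = (\<lambda>j\<in>{0..n}. y (Transposition.transpose 0 i j))" for y :: "nat \<Rightarrow> 'a"
  have T: "T \<in> Sample {0..n} \<rightarrow>\<^sub>M Sample {0..n}"
    unfolding T_def using i
    by (intro measurable_restrict measurable_component_singleton) (auto simp: Transposition.transpose_def)
  have distr_T: "distr (Sample {0..n}) (Sample {0..n}) T = Sample {0..n}"
    unfolding T_def
    using distr_PiM_reindex[of "{0..n}" "\<lambda>_. P" "Transposition.transpose 0 i" "{0..n}"] i
    by (auto simp: prob_space_axioms Transposition.transpose_def)
  have HT: "H 0 (T y) = H i y" for y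
  proof -
    have "resample n 0 (T y) = resample n i y"
      using i by (auto simp: resample_def T_def replace_index_def Transposition.transpose_def fun_eq_iff)
    then show ?thesis by (simp add: H_def T_def)
  qed
  have "(\<integral>y. H 0 y \<partial>distr (Sample {0..n}) (Sample {0..n}) T) = (\<integral>y. H 0 (T y) \<partial>Sample {0..n})"
    by (rule integral_distr[OF T meas]) simp
  then have "(\<integral>y. H i y \<partial>Sample {0..n}) = (\<integral>y. H 0 y \<partial>Sample {0..n})"
    by (simp add: distr_T HT)
  also have "\<dots> = (\<integral>x. \<integral>z. H 0 (x(0 := z)) \<partial>P \<partial>Sample {1..n})"
  proof -
    have ins: "{0..n} = insert 0 {1..n}" by auto
    show ?thesis
      using Pn.product_integral_insert[of "{1..n}" 0 "H 0"] int[of 0] by (simp add: ins)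
  qed
  also have "\<dots> = (\<integral>x. \<integral>z. excess (F x) z \<partial>P \<partial>Sample {1..n})"
  proof (rule Bochner_Integration.integral_cong[OF refl])
    fix x assume x: "x \<in> space (Sample {1..n})"
    then have "resample n 0 (x(0 := z)) = x" for z
      by (auto simp: resample_def replace_index_def space_PiM fun_eq_iff PiE_def extensional_def)
    then have "H 0 (x(0 := z)) = excess (F x) (to_support z)" for z
      by (simp add: H_def)
    then show "(\<integral>z. H 0 (x(0 := z)) \<partial>P) = (\<integral>z. excess (F x) z \<partial>P)"
      by (simp add: integral_excess_to_support)
  qed
  finally show "(\<integral>y. H i y \<partial>Sample {0..n}) = (\<integral>x. \<integral>z. excess (F x) z \<partial>P \<partial>Sample {1..n})" .
qed

end

section \<open>The risk under the product measure\<close>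

context frechet_mean_model
begin

lemma integrable_expected_excess:
  fixes n :: nat and F :: "(nat \<Rightarrow> 'a) \<Rightarrow> 'a"
  assumes n: "1 \<le> n" "8 \<le> \<xi> * n" and F[measurable]: "F \<in> Sample {1..n} \<rightarrow>\<^sub>M borel"
    and min: "AE y in Sample {1..n}. minimizes {1..n} y (F y)"
  shows "integrable (Sample {1..n}) (\<lambda>y. \<integral>z. excess (F y) z \<partial>P)"
proof (rule Bochner_Integration.integrable_bound)
  interpret S: prob_space "Sample {1..n}" by (rule prob_space_PiM) (rule prob_space_axioms)
  show "integrable (Sample {1..n}) (\<lambda>y. L * (R\<^sub>0 + R\<^sub>0\<^sup>2 * (\<epsilon> n * weight {1..n} y)))"
    by (intro integrable_mult_right Bochner_Integration.integrable_add integrable_weight S.integrable_const) auto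
  have "(\<lambda>(y, z). excess (F y) (to_support z)) \<in> borel_measurable (Sample {1..n} \<Otimes>\<^sub>M P)"
    unfolding split_beta'
    using measurable_compose[OF measurable_fst F] measurable_compose[OF measurable_snd measurable_to_support]
    by (intro borel_measurable_diff borel_measurable_loss borel_measurable_dist_of_separable[where c=c]
        to_support_in zero_le_dist measurable_const) simp_all
  then have "(\<lambda>y. \<integral>z. excess (F y) (to_support z) \<partial>P) \<in> borel_measurable (Sample {1..n})"
    by (rule borel_measurable_lebesgue_integral)
  moreover have "(\<integral>z. excess q (to_support z) \<partial>P) = (\<integral>z. excess q z \<partial>P)" for q
    by (rule integral_excess_to_support)
  ultimately show "(\<lambda>y. \<integral>z. excess (F y) z \<partial>P) \<in> borel_measurable (Sample {1..n})"
    by simp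
  show "AE y in Sample {1..n}. norm (\<integral>z. excess (F y) z \<partial>P)
      \<le> norm (L * (R\<^sub>0 + R\<^sub>0\<^sup>2 * (\<epsilon> n * weight {1..n} y)))"
    using min
  proof eventually_elim
    fix y assume "minimizes {1..n} y (F y)"
    then have "dist (F y) m \<le> R\<^sub>0 + R\<^sub>0\<^sup>2 * (\<epsilon> n * weight {1..n} y)"
      by (rule error_le_weight[OF n])
    then have "L * dist (F y) m \<le> L * (R\<^sub>0 + R\<^sub>0\<^sup>2 * (\<epsilon> n * weight {1..n} y))"
      using L_pos by (intro mult_left_mono) auto
    moreover have "(\<integral>z. excess (F y) z \<partial>P) \<le> (\<integral>z. L * dist (F y) m \<partial>P)"
      using abs_excess_le[of _ "F y"] by (intro integral_mono integrable_excess) (auto simp: abs_le_iff)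
    ultimately show "norm (\<integral>z. excess (F y) z \<partial>P) \<le> norm (L * (R\<^sub>0 + R\<^sub>0\<^sup>2 * (\<epsilon> n * weight {1..n} y)))"
      using optimal[of "F y"] by (simp add: prob_space)
  qed
qed

text \<open>Average \<open>integral_resample_excess\<close> over \<open>i\<close>. At each observation the resampled mean may be replaced
  by the original one at the cost \<open>b y\<close> given by stability, and the original mean has
  nonpositive total excess on its own sample.\<close>

lemma expected_excess_le:
  fixes n :: nat and F :: "(nat \<Rightarrow> 'a) \<Rightarrow> 'a"
  assumes n: "1 \<le> n" "8 \<le> \<xi> * n" and F[measurable]: "F \<in> Sample {1..n} \<rightarrow>\<^sub>M borel"
    and min: "AE y in Sample {1..n}. minimizes {1..n} y (F y)"
    and \<kappa>: "strongly_midpoint_convex \<tau> (R\<^sub>1 + R\<^sub>0) \<kappa>" "0 < \<kappa>"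
  shows "(\<integral>y. \<integral>z. excess (F y) z \<partial>P \<partial>Sample {1..n}) \<le> L * (4 * L / (3 * \<kappa>) + 2 * R\<^sub>0\<^sup>2 * B) / n"
proof -
  interpret S: prob_space "Sample {0..n}" by (rule prob_space_PiM) (rule prob_space_axioms)
  define H where "H i y = excess (F (resample n i y)) (to_support (y i))" for i y
  define b where "b y = L * (4 * L / (3 * \<kappa> * n) + 2 * R\<^sub>0\<^sup>2 * (\<epsilon> n * weight {0..n} y))" for y
  define E where "E = (\<integral>y. \<integral>z. excess (F y) z \<partial>P \<partial>Sample {1..n})"
  have H: "integrable (Sample {0..n}) (H i)" "(\<integral>y. H i y \<partial>Sample {0..n}) = E" if "i \<in> {1..n}" for i
    using integral_resample_excess[OF n F min, of i] that unfolding H_def E_def by auto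
  have b: "integrable (Sample {0..n}) b"
    unfolding b_def
    by (intro integrable_mult_right Bochner_Integration.integrable_add integrable_weight S.integrable_const) auto
  have "n * E = (\<Sum>i\<in>{1..n}. \<integral>y. H i y \<partial>Sample {0..n})"
    using H(2) by simp
  also have "\<dots> = (\<integral>y. (\<Sum>i\<in>{1..n}. H i y) \<partial>Sample {0..n})"
    by (rule Bochner_Integration.integral_sum[symmetric]) (rule H(1))
  also have "\<dots> \<le> (\<integral>y. n * b y \<partial>Sample {0..n})"
  proof (rule integral_mono_AE)
    show "integrable (Sample {0..n}) (\<lambda>y. \<Sum>i\<in>{1..n}. H i y)"
      by (rule Bochner_Integration.integrable_sum) (rule H(1))
    show "integrable (Sample {0..n}) (\<lambda>y. n * b y)"
      using b by simp
    have "AE y in Sample {0..n}. \<forall>i\<in>{0..n}. minimizes {1..n} (resample n i y) (F (resample n i y))"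
      by (subst AE_finite_all) (simp, intro ballI AE_resample[OF min])
    with AE_sample_to_support[OF finite_atLeastAtMost]
    show "AE y in Sample {0..n}. (\<Sum>i\<in>{1..n}. H i y) \<le> n * b y"
    proof eventually_elim
      fix y
      assume supp: "\<forall>j\<in>{0..n}. to_support (y j) = y j"
        and mins: "\<forall>i\<in>{0..n}. minimizes {1..n} (resample n i y) (F (resample n i y))"
      let ?q = "\<lambda>i. F (resample n i y)"
      have min0: "minimizes {1..n} (resample n 0 y) (?q 0)" using mins by simp
      have "H i y \<le> excess (?q 0) (y i) + b y" if i: "i \<in> {1..n}" for i
      proof -
        have "dist (?q 0) (?q i) \<le> 4 * L / (3 * \<kappa> * n) + 2 * R\<^sub>0\<^sup>2 * (\<epsilon> n * weight {0..n} y)"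
          using mins i by (intro resample_stability[OF n i \<kappa> min0]) auto
        then have "L * dist (?q 0) (?q i) \<le> b y"
          unfolding b_def using L_pos by (intro mult_left_mono) auto
        moreover have "excess (?q i) (y i) - excess (?q 0) (y i) \<le> L * dist (?q 0) (?q i)"
          using loss_dist_diff_le[of "y i" "?q i" "?q 0"] by (simp add: dist_commute)
        moreover have "H i y = excess (?q i) (y i)" using supp i by (simp add: H_def)
        ultimately show ?thesis by linarith
      qed
      then have "(\<Sum>i\<in>{1..n}. H i y) \<le> (\<Sum>i\<in>{1..n}. excess (?q 0) (y i) + b y)"
        by (rule sum_mono)
      also have "\<dots> = (\<Sum>i\<in>{1..n}. excess (?q 0) (y i)) + n * b y"
        by (simp add: sum.distrib)
      also have "(\<Sum>i\<in>{1..n}. excess (?q 0) (y i)) \<le> 0"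
      proof -
        have "resample n 0 y j = y j" if "j \<in> {1..n}" for j
          using that by (auto simp: resample_def replace_index_def)
        then show ?thesis
          using min0[unfolded minimizes_def, rule_format, of m] by (simp add: sum_subtractf)
      qed
      finally show "(\<Sum>i\<in>{1..n}. H i y) \<le> n * b y" by simp
    qed
  qed
  also have "\<dots> = n * (\<integral>y. b y \<partial>Sample {0..n})" by simp
  finally have "E \<le> (\<integral>y. b y \<partial>Sample {0..n})"
    using n by simp
  also have "(\<integral>y. b y \<partial>Sample {0..n}) = L * (4 * L / (3 * \<kappa> * n) + 2 * R\<^sub>0\<^sup>2 * (\<epsilon> n * B ^ Suc n))"
    unfolding b_def
    using integrable_weight[of "{0..n}"] by (simp add: integral_weight S.prob_space)
  also have "\<epsilon> n * B ^ Suc n = B * (1 / 2 ^ n)"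
    using B_ge_1 by (simp add: \<epsilon>_eq power_mult_distrib)
  also have "L * (4 * L / (3 * \<kappa> * n) + 2 * R\<^sub>0\<^sup>2 * (B * (1 / 2 ^ n)))
      \<le> L * (4 * L / (3 * \<kappa> * n) + 2 * R\<^sub>0\<^sup>2 * (B * (1 / n)))"
    using L_pos B_ge_1 inverse_power2_le[OF n(1)]
    by (intro mult_left_mono add_left_mono) auto
  also have "\<dots> = L * (4 * L / (3 * \<kappa>) + 2 * R\<^sub>0\<^sup>2 * B) / n"
    using n \<kappa> by (simp add: field_simps)
  finally show ?thesis unfolding E_def .
qed

text \<open>The error is split at \<open>R\<^sub>0\<close>: below it the variance inequality at \<open>m\<close> reduces the
  second moment to the expected excess, beyond it the tail bound applies.\<close>

lemma risk_le:
  fixes n :: nat and F :: "(nat \<Rightarrow> 'a) \<Rightarrow> 'a"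
  assumes n: "1 \<le> n" "8 \<le> \<xi> * n" and F[measurable]: "F \<in> Sample {1..n} \<rightarrow>\<^sub>M borel"
    and min: "AE y in Sample {1..n}. minimizes {1..n} y (F y)"
    and \<kappa>: "strongly_midpoint_convex \<tau> (R\<^sub>1 + R\<^sub>0) \<kappa>" "0 < \<kappa>"
  shows "(\<integral>\<^sup>+y. ennreal ((dist m (F y))\<^sup>2) \<partial>Sample {1..n})
    \<le> ennreal ((L * (4 * L / (3 * \<kappa>) + 2 * R\<^sub>0\<^sup>2 * B) / \<kappa> + R\<^sub>0\<^sup>2) / n)"
proof -
  interpret S: prob_space "Sample {1..n}" by (rule prob_space_PiM) (rule prob_space_axioms)
  define e where "e y = dist (F y) m" for y
  have [measurable]: "e \<in> borel_measurable (Sample {1..n})"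
    unfolding e_def
    by (rule measurable_compose[OF F]) (intro borel_measurable_continuous_onI continuous_intros)
  define g where "g y = (if e y \<le> R\<^sub>0 then (e y)\<^sup>2 else 0)" for y
  define w where "w y = R\<^sub>0\<^sup>2 * (\<epsilon> n * weight {1..n} y)" for y
  have g: "integrable (Sample {1..n}) g"
  proof (rule S.integrable_const_bound)
    show "AE y in Sample {1..n}. norm (g y) \<le> R\<^sub>0\<^sup>2"
      by (auto simp: g_def e_def intro!: power_mono)
    show "g \<in> borel_measurable (Sample {1..n})" unfolding g_def by measurable
  qed
  have w: "integrable (Sample {1..n}) w"
    unfolding w_def by (intro integrable_mult_right integrable_weight) auto
  have w_nonneg: "0 \<le> w y" for y
    using \<epsilon>_pos[of n] weight_ge_1[of "{1..n}" y] by (simp add: w_def)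
  have "\<kappa> * (\<integral>y. g y \<partial>Sample {1..n}) = (\<integral>y. \<kappa> * g y \<partial>Sample {1..n})"
    by simp
  also have "\<dots> \<le> (\<integral>y. \<integral>z. excess (F y) z \<partial>P \<partial>Sample {1..n})"
  proof (rule integral_mono)
    show "\<kappa> * g y \<le> (\<integral>z. excess (F y) z \<partial>P)" for y
      using expected_excess_ge[OF \<kappa>, of "F y"] optimal[of "F y"] by (auto simp: g_def e_def)
  qed (use g integrable_expected_excess[OF n F min] in auto)
  also have "\<dots> \<le> L * (4 * L / (3 * \<kappa>) + 2 * R\<^sub>0\<^sup>2 * B) / n"
    by (rule expected_excess_le[OF n F min \<kappa>])
  finally have "(\<integral>y. g y \<partial>Sample {1..n}) \<le> L * (4 * L / (3 * \<kappa>) + 2 * R\<^sub>0\<^sup>2 * B) / n / \<kappa>"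
    unfolding pos_le_divide_eq[OF \<kappa>(2)] by (simp only: mult.commute)
  then have int_g: "(\<integral>y. g y \<partial>Sample {1..n}) \<le> L * (4 * L / (3 * \<kappa>) + 2 * R\<^sub>0\<^sup>2 * B) / \<kappa> / n"
    by (simp only: divide_divide_eq_left mult.commute)
  have "(\<integral>y. w y \<partial>Sample {1..n}) = R\<^sub>0\<^sup>2 * (\<epsilon> n * B ^ n)"
    unfolding w_def using integral_weight[of "{1..n}"] by simp
  also have "\<epsilon> n * B ^ n = 1 / 2 ^ n"
    using B_ge_1 by (simp add: \<epsilon>_eq power_mult_distrib)
  also have "R\<^sub>0\<^sup>2 * (1 / 2 ^ n) \<le> R\<^sub>0\<^sup>2 * (1 / n)"
    using inverse_power2_le[OF n(1)] by (intro mult_left_mono) auto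
  finally have int_w: "(\<integral>y. w y \<partial>Sample {1..n}) \<le> R\<^sub>0\<^sup>2 / n" by simp
  have "(\<integral>\<^sup>+y. ennreal ((dist m (F y))\<^sup>2) \<partial>Sample {1..n}) \<le> (\<integral>\<^sup>+y. ennreal (g y + w y) \<partial>Sample {1..n})"
  proof (rule nn_integral_mono_AE)
    show "AE y in Sample {1..n}. ennreal ((dist m (F y))\<^sup>2) \<le> ennreal (g y + w y)"
      using min
    proof eventually_elim
      fix y assume min_y: "minimizes {1..n} y (F y)"
      have "(e y)\<^sup>2 \<le> g y + w y"
        using w_nonneg[of y] squared_error_le_weight[OF n min_y]
        by (auto simp: g_def e_def w_def)
      then show "ennreal ((dist m (F y))\<^sup>2) \<le> ennreal (g y + w y)"
        by (simp add: e_def dist_commute ennreal_leI)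
    qed
  qed
  also have "\<dots> = ennreal (\<integral>y. g y + w y \<partial>Sample {1..n})"
    using w_nonneg
    by (intro nn_integral_eq_integral Bochner_Integration.integrable_add g w) (auto simp: g_def)
  also have "\<dots> \<le> ennreal ((L * (4 * L / (3 * \<kappa>) + 2 * R\<^sub>0\<^sup>2 * B) / \<kappa> + R\<^sub>0\<^sup>2) / n)"
    using int_g int_w g w by (intro ennreal_leI) (simp add: add_divide_distrib)
  finally show ?thesis .
qed

end

section \<open>The risk for independent copies\<close>

context linear_growth_loss
begin

lemma minimizes_cong:
  "(\<And>j. j \<in> I \<Longrightarrow> y j = z j) \<Longrightarrow> minimizes I y q \<longleftrightarrow> minimizes I z q"
  by (simp add: minimizes_def)

end

context frechet_mean_model
begin

text \<open>An almost sure property of a random variable passes to its law if the property is measurable, but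
  not in general. The minimization property agrees almost surely with a measurable one, in which the
  observations are moved into the closure of \<open>range c\<close>.\<close>

lemma AE_minimizes_transfer:
  fixes X :: "'c \<Rightarrow> nat \<Rightarrow> 'a"
  assumes I: "finite I" and X: "X \<in> N \<rightarrow>\<^sub>M Sample I" and law: "distr N (Sample I) X = Sample I"
    and F: "F \<in> Sample I \<rightarrow>\<^sub>M borel" and min: "AE \<omega> in N. minimizes I (X \<omega>) (F (X \<omega>))"
  shows "AE y in Sample I. minimizes I y (F y)"
proof -
  let ?Q = "\<lambda>y. minimizes I (\<lambda>j. to_support (y j)) (F y)"
  have Q: "Measurable.pred (Sample I) ?Q"
    using measurable_compose[OF measurable_component_singleton[of _ I "\<lambda>_. P"] measurable_to_support]
    by (intro pred_minimizes_of_separable[OF I _ to_support_in F])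
  have "AE \<omega> in N. \<forall>j\<in>I. to_support (X \<omega> j) = X \<omega> j"
    using AE_distrD[OF X, unfolded law, OF AE_sample_to_support[OF I]] .
  with min have "AE \<omega> in N. ?Q (X \<omega>)"
  proof eventually_elim
    fix \<omega> assume "minimizes I (X \<omega>) (F (X \<omega>))" "\<forall>j\<in>I. to_support (X \<omega> j) = X \<omega> j"
    then show "?Q (X \<omega>)"
      using minimizes_cong[of I "X \<omega>" "\<lambda>j. to_support (X \<omega> j)"] by simp
  qed
  then have "AE y in distr N (Sample I) X. ?Q y"
    using Q by (subst AE_distr_iff[OF X]) (auto simp: pred_def)
  then have "AE y in Sample I. ?Q y" unfolding law .
  with AE_sample_to_support[OF I] show ?thesis
  proof eventually_elim
    fix y assume "?Q y" "\<forall>j\<in>I. to_support (y j) = y j"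
    then show "minimizes I y (F y)"
      using minimizes_cong[of I y "\<lambda>j. to_support (y j)"] by simp
  qed
qed

lemma risk_of_independent_copies_le:
  fixes n :: nat and N :: "'c measure"
  assumes n: "1 \<le> n" "8 \<le> \<xi> * n"
    and \<kappa>: "strongly_midpoint_convex \<tau> (R\<^sub>1 + R\<^sub>0) \<kappa>" "0 < \<kappa>"
    and copies: "independent_copies M Y n N Ys" and P: "distr M borel Y = P"
    and mean: "empirical_frechet_mean \<tau> n N Ys mn"
  shows "(\<integral>\<^sup>+\<omega>. ennreal ((dist m (mn \<omega>))\<^sup>2) \<partial>N)
    \<le> ennreal ((L * (4 * L / (3 * \<kappa>) + 2 * R\<^sub>0\<^sup>2 * B) / \<kappa> + R\<^sub>0\<^sup>2) / n)"
proof -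
  interpret N: prob_space N using copies by (simp add: independent_copies_def)
  define X where "X \<omega> = (\<lambda>j\<in>{1..n}. Ys j \<omega>)" for \<omega>
  have sets_Sample: "sets (Sample {1..n}) = sets (Pi\<^sub>M {1..n} (\<lambda>_. borel))"
    by (rule sets_PiM_cong[OF refl sets_P])
  have indep: "N.indep_vars (\<lambda>_. borel) Ys {1..n}"
    using copies by (simp add: independent_copies_def)
  then have Ys: "Ys j \<in> N \<rightarrow>\<^sub>M borel" if "j \<in> {1..n}" for j
    using that by (auto simp: N.indep_vars_def)
  then have X: "X \<in> N \<rightarrow>\<^sub>M Sample {1..n}"
    unfolding X_def measurable_cong_sets[OF refl sets_Sample] by (rule measurable_restrict)
  have "distr N (Sample {1..n}) X = distr N (Pi\<^sub>M {1..n} (\<lambda>_. borel)) X"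
    by (rule distr_cong[OF refl sets_Sample refl])
  also have "\<dots> = Pi\<^sub>M {1..n} (\<lambda>j. distr N borel (Ys j))"
    unfolding X_def using N.indep_vars_iff_distr_eq_PiM'[of "{1..n}" Ys "\<lambda>_. borel"] indep Ys n by auto
  also have "\<dots> = Sample {1..n}"
    using copies P by (intro PiM_cong) (auto simp: independent_copies_def)
  finally have law: "distr N (Sample {1..n}) X = Sample {1..n}" .
  obtain F where F: "F \<in> Sample {1..n} \<rightarrow>\<^sub>M borel" and mn: "\<And>\<omega>. \<omega> \<in> space N \<Longrightarrow> mn \<omega> = F (X \<omega>)"
    using mean unfolding empirical_frechet_mean_def X_def measurable_cong_sets[OF sets_Sample refl] by blast
  have "AE \<omega> in N. is_arg_min (\<lambda>q. \<Sum>j=1..n. \<tau> (dist (Ys j \<omega>) q)) (\<lambda>_. True) (mn \<omega>)"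
    using mean by (simp add: empirical_frechet_mean_def)
  then have "AE \<omega> in N. minimizes {1..n} (X \<omega>) (F (X \<omega>))"
    using AE_space
  proof eventually_elim
    fix \<omega> assume "is_arg_min (\<lambda>q. \<Sum>j=1..n. \<tau> (dist (Ys j \<omega>) q)) (\<lambda>_. True) (mn \<omega>)" "\<omega> \<in> space N"
    then have "minimizes {1..n} (\<lambda>j. Ys j \<omega>) (F (X \<omega>))"
      by (simp add: is_arg_min_linorder minimizes_def mn)
    then show "minimizes {1..n} (X \<omega>) (F (X \<omega>))"
      by (subst minimizes_cong[of _ _ "\<lambda>j. Ys j \<omega>"]) (auto simp: X_def)
  qed
  from AE_minimizes_transfer[OF finite_atLeastAtMost X law F this]
  have min: "AE y in Sample {1..n}. minimizes {1..n} y (F y)" .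
  have "(\<lambda>y. ennreal ((dist m (F y))\<^sup>2)) \<in> borel_measurable (Sample {1..n})"
    by (rule measurable_compose[OF F], rule measurable_compose[OF _ measurable_ennreal])
      (intro borel_measurable_continuous_onI continuous_intros)
  then have "(\<integral>\<^sup>+\<omega>. ennreal ((dist m (F (X \<omega>)))\<^sup>2) \<partial>N) = (\<integral>\<^sup>+y. ennreal ((dist m (F y))\<^sup>2) \<partial>distr N (Sample {1..n}) X)"
    by (intro nn_integral_distr[symmetric] X) simp
  moreover have "(\<integral>\<^sup>+\<omega>. ennreal ((dist m (mn \<omega>))\<^sup>2) \<partial>N) = (\<integral>\<^sup>+\<omega>. ennreal ((dist m (F (X \<omega>)))\<^sup>2) \<partial>N)"
    by (rule nn_integral_cong) (simp add: mn)
  ultimately show ?thesis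
    using risk_le[OF n F min \<kappa>] by (simp only: law)
qed

end

lemma concentrated_on_separable_imp_dense_sequence:
  fixes Y :: "'b \<Rightarrow> 'a::metric_space"
  assumes "prob_space M" and Y: "Y \<in> M \<rightarrow>\<^sub>M borel" and "concentrated_on_separable M Y"
  shows "\<exists>c :: nat \<Rightarrow> 'a. AE y in distr M borel Y. y \<in> closure (range c)"
proof -
  interpret prob_space M by fact
  obtain S where S: "separable_space (top_of_set S)" "prob {\<omega>\<in>space M. Y \<omega> \<in> S} = 1"
    using assms(3) by (auto simp: concentrated_on_separable_def)
  obtain D where D: "countable D" "D \<subseteq> S" "top_of_set S closure_of D = S"
    using S(1) by (auto simp: separable_space_def)
  have "S \<subseteq> closure D"
    using D(3) by (auto simp: closure_of_subtopology Int_absorb1[OF D(2)])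
  moreover have "D \<noteq> {}"
  proof
    assume "D = {}"
    with \<open>S \<subseteq> closure D\<close> have "{\<omega>\<in>space M. Y \<omega> \<in> S} = {}" by auto
    then show False using S(2) by (metis measure_empty zero_neq_one)
  qed
  ultimately have c: "S \<subseteq> closure (range (from_nat_into D))"
    using D(1) by (simp add: range_from_nat_into)
  have "{\<omega>\<in>space M. Y \<omega> \<in> S} \<in> sets M"
    using S(2) measure_notin_sets by fastforce
  then have "AE \<omega> in M. Y \<omega> \<in> S"
    using S(2) prob_eq_1 by simp
  then have "AE \<omega> in M. Y \<omega> \<in> closure (range (from_nat_into D))"
    by eventually_elim (use c in auto)
  then show ?thesis
    by (intro exI[of _ "from_nat_into D"], subst AE_distr_iff[OF Y]) auto
qed

theorem theorem4p13:
  fixes M :: "'b measure" and Y :: "'b \<Rightarrow> 'a::hadamard_space"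
    and \<tau> :: "real \<Rightarrow> real" and m r :: 'a and \<xi> :: real
  assumes "prob_space M"
    and "\<tau> \<in> S0_plus"
    and "Y \<in> M \<rightarrow>\<^sub>M borel"
    and "concentrated_on_separable M Y"
    and "frechet_mean \<tau> M Y r m"
    and "\<exists>L::real. (deriv \<tau> \<longlongrightarrow> L) at_top"
    and "\<And>x. x > 0 \<Longrightarrow> \<exists>D>0. (deriv \<tau> has_real_derivative D) (at_right x)"
    and "\<xi> > 0"
    and "integrable M (\<lambda>\<omega>. dist (Y \<omega>) m powr \<xi>)"
  shows "\<exists>(C::real) n0. \<forall>n\<ge>n0. \<forall>(N::'c measure) Ys mn.
     independent_copies M Y n N Ys \<longrightarrow> empirical_frechet_mean \<tau> n N Ys mn \<longrightarrow>
     (\<integral>\<^sup>+\<omega>. ennreal ((dist m (mn \<omega>))\<^sup>2) \<partial>N) \<le> ennreal (C / real n)"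
proof -
  interpret M: prob_space M by fact
  note Y = assms(3)
  obtain L x\<^sub>0 where "linear_growth_loss \<tau> L x\<^sub>0"
    using S0_plus_imp_linear_growth_loss[OF assms(2) _ assms(7)] assms(6) by blast
  then interpret linear_growth_loss \<tau> L x\<^sub>0 .
  define P where "P = distr M borel Y"
  obtain c :: "nat \<Rightarrow> 'a" where c: "AE y in P. y \<in> closure (range c)"
    using concentrated_on_separable_imp_dense_sequence[OF assms(1,3,4)] unfolding P_def by blast
  have meas_dist: "(\<lambda>y. dist y q) \<in> borel_measurable borel" for q :: 'a
    by (intro borel_measurable_continuous_onI continuous_intros)
  have int: "integrable M (\<lambda>\<omega>. \<tau> (dist (Y \<omega>) q) - \<tau> (dist (Y \<omega>) r))" for q
    by (rule M.integrable_const_bound[of _ "L * dist q r"])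
      (use loss_dist_diff_le in \<open>auto intro!: borel_measurable_diff borel_measurable_loss
        measurable_compose[OF Y meas_dist]\<close>)
  have "0 \<le> (\<integral>y. \<tau> (dist y q) - \<tau> (dist y m) \<partial>P)" for q
  proof -
    have "(\<integral>\<omega>. \<tau> (dist (Y \<omega>) m) - \<tau> (dist (Y \<omega>) r) \<partial>M) \<le> (\<integral>\<omega>. \<tau> (dist (Y \<omega>) q) - \<tau> (dist (Y \<omega>) r) \<partial>M)"
      using assms(5) by (simp add: frechet_mean_def is_arg_min_linorder)
    then have "0 \<le> (\<integral>\<omega>. (\<tau> (dist (Y \<omega>) q) - \<tau> (dist (Y \<omega>) r)) - (\<tau> (dist (Y \<omega>) m) - \<tau> (dist (Y \<omega>) r)) \<partial>M)"
      by (subst Bochner_Integration.integral_diff[OF int int]) simp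
    also have "\<dots> = (\<integral>y. \<tau> (dist y q) - \<tau> (dist y m) \<partial>P)"
      unfolding P_def
      by (subst integral_distr[OF Y])
        (auto intro!: borel_measurable_diff borel_measurable_loss meas_dist)
    finally show ?thesis .
  qed
  moreover have "integrable P (\<lambda>y. dist y m powr \<xi>)"
    unfolding P_def using assms(9)
    by (subst integrable_distr_eq[OF Y]) (auto intro!: powr_real_measurable meas_dist)
  ultimately interpret frechet_mean_model \<tau> L x\<^sub>0 P m c \<xi>
    by (intro frechet_mean_model.intro frechet_mean_model_axioms.intro)
      (use c assms(8) linear_growth_loss_axioms M.prob_space_distr[OF Y] in \<open>auto simp: P_def\<close>)
  obtain \<kappa> where \<kappa>: "strongly_midpoint_convex \<tau> (R\<^sub>1 + R\<^sub>0) \<kappa>" "0 < \<kappa>"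
    using strong_midpoint by blast
  show ?thesis
  proof (intro exI allI impI)
    fix n :: nat and N :: "'c measure" and Ys mn
    assume n: "max 1 (nat \<lceil>8 / \<xi>\<rceil>) \<le> n"
      and copies: "independent_copies M Y n N Ys" and mean: "empirical_frechet_mean \<tau> n N Ys mn"
    have "1 \<le> n" using n by simp
    have "8 / \<xi> \<le> n" using n by linarith
    then have "8 \<le> \<xi> * n" using \<open>\<xi> > 0\<close> by (simp add: field_simps)
    show "(\<integral>\<^sup>+\<omega>. ennreal ((dist m (mn \<omega>))\<^sup>2) \<partial>N)
      \<le> ennreal ((L * (4 * L / (3 * \<kappa>) + 2 * R\<^sub>0\<^sup>2 * B) / \<kappa> + R\<^sub>0\<^sup>2) / n)"
      by (rule risk_of_independent_copies_le[OF \<open>1 \<le> n\<close> \<open>8 \<le> \<xi> * n\<close> \<kappa> copies P_def[symmetric] mean])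
  qed
qed

end
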